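(* Let $M$ be a connected complex Fréchet manifold and let $K\colon M\times\overline M\to\mathbb C$ be a holomorphic kernel on $M$. Each of the following conditions is sufficient for $K$ to be positive definite (on $M$): (i) $K$ is positive definite on a non-empty open subset of $M$. (ii) $K$ is positive definite on a non-empty totally real submanifold of $M$.
   Context: $\overline M$ denotes the complex conjugate manifold of $M$; a holomorphic kernel on $M$ is a holomorphic function $K\colon M\times\overline M\to\mathbb C$. For a subset $X\subseteq M$, $K$ is positive definite on $X$ if $\sum_{j,k=1}^m c_k\overline{c_j}\,K(x_j,x_k)\ge0$ for all finite families $x_j\in X$, $c_j\in\mathbb C$. A submanifold $\Sigma\subseteq M$ is called totally real if for each $s\in\Sigma$ there exists a holomorphic chart $\phi\colon U\to V_{\mathbb C}$, where $U$ is an open neighborhood of $s$ in $M$ and $V_{\mathbb C}$ is the complexification of a real locally convex space $V$, such that $\phi(U\cap\Sigma)=\phi(U)\cap V$. *)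

theory Defs
  imports "HOL-Analysis.Analysis"
begin

section \<open>Locally convex spaces\<close>

text \<open>A topological vector space is given by a topology, whose \<^const>\<open>topspace\<close> is the carrier, and
  a scalar multiplication; addition is inherited from the ambient type. The space is thus a value
  and not a type, so it may vary from chart to chart, and conjugation and complexification are
  operations on spaces.\<close>

record ('k, 'a) tvs =
  vtop :: "'a topology"
  vscale :: "'k \<Rightarrow> 'a \<Rightarrow> 'a"

abbreviation vcarrier :: "('k, 'a) tvs \<Rightarrow> 'a set" where
  "vcarrier E \<equiv> topspace (vtop E)"

definition is_vector_space :: "('k::field, 'a::ab_group_add) tvs \<Rightarrow> bool" where
  "is_vector_space E \<longleftrightarrow>
     0 \<in> vcarrier E \<and>
     (\<forall>x\<in>vcarrier E. \<forall>y\<in>vcarrier E. x + y \<in> vcarrier E) \<and>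
     (\<forall>c. \<forall>x\<in>vcarrier E. vscale E c x \<in> vcarrier E) \<and>
     (\<forall>c. \<forall>x\<in>vcarrier E. \<forall>y\<in>vcarrier E. vscale E c (x + y) = vscale E c x + vscale E c y) \<and>
     (\<forall>c d. \<forall>x\<in>vcarrier E. vscale E (c + d) x = vscale E c x + vscale E d x) \<and>
     (\<forall>c d. \<forall>x\<in>vcarrier E. vscale E (c * d) x = vscale E c (vscale E d x)) \<and>
     (\<forall>x\<in>vcarrier E. vscale E 1 x = x)"

definition is_tvs :: "('k::real_normed_field, 'a::ab_group_add) tvs \<Rightarrow> bool" where
  "is_tvs E \<longleftrightarrow>
     is_vector_space E \<and>
     Hausdorff_space (vtop E) \<and>
     continuous_map (prod_topology (vtop E) (vtop E)) (vtop E) (\<lambda>(x, y). x + y) \<and>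
     continuous_map (prod_topology euclidean (vtop E)) (vtop E) (\<lambda>(c, x). vscale E c x)"

definition convex_in :: "('k::real_normed_field, 'a::ab_group_add) tvs \<Rightarrow> 'a set \<Rightarrow> bool" where
  "convex_in E C \<longleftrightarrow>
     (\<forall>x\<in>C. \<forall>y\<in>C. \<forall>t\<in>{0..1}. vscale E (of_real (1 - t)) x + vscale E (of_real t) y \<in> C)"

definition is_lcs :: "('k::real_normed_field, 'a::ab_group_add) tvs \<Rightarrow> bool" where
  "is_lcs E \<longleftrightarrow>
     is_tvs E \<and>
     (\<forall>W. openin (vtop E) W \<and> 0 \<in> W \<longrightarrow>
       (\<exists>C. openin (vtop E) C \<and> 0 \<in> C \<and> C \<subseteq> W \<and> convex_in E C))"

definition is_frechet :: "('k::real_normed_field, 'a::ab_group_add) tvs \<Rightarrow> bool" where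
  "is_frechet E \<longleftrightarrow>
     is_lcs E \<and>
     (\<exists>d. Metric_space (vcarrier E) d \<and>
          Metric_space.mtopology (vcarrier E) d = vtop E \<and>
          Metric_space.mcomplete (vcarrier E) d \<and>
          (\<forall>x\<in>vcarrier E. \<forall>y\<in>vcarrier E. \<forall>z\<in>vcarrier E. d (x + z) (y + z) = d x y))"

definition complex_line :: "(complex, complex) tvs" where
  "complex_line = \<lparr>vtop = euclidean, vscale = (*)\<rparr>"

definition conj_tvs :: "(complex, 'a) tvs \<Rightarrow> (complex, 'a) tvs" where
  "conj_tvs E = \<lparr>vtop = vtop E, vscale = (\<lambda>c. vscale E (cnj c))\<rparr>"

definition prod_tvs :: "('k, 'a) tvs \<Rightarrow> ('k, 'b) tvs \<Rightarrow> ('k, 'a \<times> 'b) tvs" where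
  "prod_tvs E F =
     \<lparr>vtop = prod_topology (vtop E) (vtop F),
      vscale = (\<lambda>c (x, y). (vscale E c x, vscale F c y))\<rparr>"

text \<open>The pair \<open>(v, w)\<close> stands for \<open>v + \<i> w\<close>; the real space \<open>V\<close> sits inside as
  \<open>vcarrier V \<times> {0}\<close>.\<close>

definition complexification :: "(real, 'v::ab_group_add) tvs \<Rightarrow> (complex, 'v \<times> 'v) tvs" where
  "complexification V =
     \<lparr>vtop = prod_topology (vtop V) (vtop V),
      vscale = (\<lambda>c (v, w). (vscale V (Re c) v - vscale V (Im c) w,
                             vscale V (Re c) w + vscale V (Im c) v))\<rparr>"


section \<open>Holomorphic maps\<close>

text \<open>Holomorphic means \<open>C\<^sup>1\<close> over the complex numbers in the sense of Michal--Bastiani: \<open>f\<close> is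
  continuous, its directional derivatives exist as limits over complex \<open>t\<close>, and they depend
  jointly continuously on the base point and the direction. Complex linearity in the direction
  follows.\<close>

definition holo_on ::
  "(complex, 'a::ab_group_add) tvs \<Rightarrow> (complex, 'b::ab_group_add) tvs \<Rightarrow> 'a set \<Rightarrow> ('a \<Rightarrow> 'b) \<Rightarrow> bool"
where
  "holo_on E F A f \<longleftrightarrow>
     openin (vtop E) A \<and>
     continuous_map (subtopology (vtop E) A) (vtop F) f \<and>
     (\<exists>df.
       (\<forall>x\<in>A. \<forall>v\<in>vcarrier E.
          limitin (vtop F) (\<lambda>t. vscale F (inverse t) (f (x + vscale E t v) - f x))
            (df (x, v)) (at (0::complex))) \<and>
       continuous_map (prod_topology (subtopology (vtop E) A) (vtop E)) (vtop F) df)"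


section \<open>Complex manifolds\<close>

text \<open>A chart consists of its model space, its domain, and its coordinate map, which is
  irrelevant outside the domain.\<close>

type_synonym ('m, 'e) chart = "(complex, 'e) tvs \<times> 'm set \<times> ('m \<Rightarrow> 'e)"

definition is_chart :: "'m topology \<Rightarrow> ('m, 'e) chart \<Rightarrow> bool" where
  "is_chart T = (\<lambda>(E, U, \<phi>).
     openin T U \<and> openin (vtop E) (\<phi> ` U) \<and>
     homeomorphic_map (subtopology T U) (subtopology (vtop E) (\<phi> ` U)) \<phi>)"

definition compatible ::
  "('m, 'e::ab_group_add) chart \<Rightarrow> ('m, 'f::ab_group_add) chart \<Rightarrow> bool"
where
  "compatible = (\<lambda>(E, U, \<phi>) (F, V, \<psi>).
     holo_on E F (\<phi> ` (U \<inter> V)) (\<psi> \<circ> inv_into U \<phi>) \<and>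
     holo_on F E (\<psi> ` (U \<inter> V)) (\<phi> \<circ> inv_into V \<psi>))"

record ('m, 'e) cmanifold =
  mtop :: "'m topology"
  matlas :: "('m, 'e) chart set"

definition complex_frechet_manifold :: "('m, 'e::ab_group_add) cmanifold \<Rightarrow> bool" where
  "complex_frechet_manifold M \<longleftrightarrow>
     Hausdorff_space (mtop M) \<and>
     (\<Union>(E, U, \<phi>)\<in>matlas M. U) = topspace (mtop M) \<and>
     (\<forall>(E, U, \<phi>)\<in>matlas M. is_frechet E \<and> is_chart (mtop M) (E, U, \<phi>)) \<and>
     (\<forall>a\<in>matlas M. \<forall>b\<in>matlas M. compatible a b)"

definition holomorphic_chart ::
  "('m, 'e::ab_group_add) cmanifold \<Rightarrow> ('m, 'f::ab_group_add) chart \<Rightarrow> bool"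
where
  "holomorphic_chart M a \<longleftrightarrow> is_chart (mtop M) a \<and> (\<forall>b\<in>matlas M. compatible a b)"

definition conj_manifold :: "('m, 'e) cmanifold \<Rightarrow> ('m, 'e) cmanifold" where
  "conj_manifold M =
     \<lparr>mtop = mtop M, matlas = (\<lambda>(E, U, \<phi>). (conj_tvs E, U, \<phi>)) ` matlas M\<rparr>"

definition prod_manifold ::
  "('m, 'e) cmanifold \<Rightarrow> ('n, 'f) cmanifold \<Rightarrow> ('m \<times> 'n, 'e \<times> 'f) cmanifold"
where
  "prod_manifold M N =
     \<lparr>mtop = prod_topology (mtop M) (mtop N),
      matlas = {(prod_tvs E F, U \<times> V, map_prod \<phi> \<psi>) | E U \<phi> F V \<psi>.
                 (E, U, \<phi>) \<in> matlas M \<and> (F, V, \<psi>) \<in> matlas N}\<rparr>"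

definition holomorphic_function ::
  "('m, 'e::ab_group_add) cmanifold \<Rightarrow> ('m \<Rightarrow> complex) \<Rightarrow> bool"
where
  "holomorphic_function M f \<longleftrightarrow>
     (\<forall>(E, U, \<phi>)\<in>matlas M. holo_on E complex_line (\<phi> ` U) (f \<circ> inv_into U \<phi>))"

text \<open>The type argument bounds the carriers of the real spaces \<open>V\<close>, which may differ from
  point to point. A set satisfying the chart condition is automatically a real submanifold,
  modelled on the spaces \<open>V\<close>.\<close>

definition totally_real_submanifold ::
  "'v::ab_group_add itself \<Rightarrow> ('m, 'e::ab_group_add) cmanifold \<Rightarrow> 'm set \<Rightarrow> bool"
where
  "totally_real_submanifold _ M \<Sigma> \<longleftrightarrow>
     \<Sigma> \<subseteq> topspace (mtop M) \<and>
     (\<forall>s\<in>\<Sigma>. \<exists>(V :: (real, 'v) tvs) U \<phi>.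
        is_lcs V \<and> s \<in> U \<and>
        holomorphic_chart M (complexification V, U, \<phi>) \<and>
        \<phi> ` (U \<inter> \<Sigma>) = \<phi> ` U \<inter> (vcarrier V \<times> {0}))"


section \<open>Positive definite kernels\<close>

definition holomorphic_kernel ::
  "('m, 'e::ab_group_add) cmanifold \<Rightarrow> ('m \<times> 'm \<Rightarrow> complex) \<Rightarrow> bool"
where
  "holomorphic_kernel M K \<longleftrightarrow> holomorphic_function (prod_manifold M (conj_manifold M)) K"

definition positive_definite_on :: "'m set \<Rightarrow> ('m \<times> 'm \<Rightarrow> complex) \<Rightarrow> bool" where
  "positive_definite_on X K \<longleftrightarrow>
     (\<forall>(m::nat) (x :: nat \<Rightarrow> 'm) (c :: nat \<Rightarrow> complex).
        (\<forall>j<m. x j \<in> X) \<longrightarrow>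
        (\<Sum>j<m. \<Sum>k<m. c k * cnj (c j) * K (x j, x k)) \<in> \<real>\<^sub>\<ge>\<^sub>0)"

end

theory Submission
  imports Defs "HOL-Complex_Analysis.Conformal_Mappings"
begin

text \<open>Let \<open>S\<close> be a maximal set on which \<open>K\<close> is positive definite. If \<open>\<gamma>\<close> is a holomorphic disc with
  \<open>\<gamma>(r) \<in> S\<close> for all small real \<open>r > 0\<close>, then Newton interpolation at nodes in this interval
  approximates evaluation at \<open>\<gamma>(t)\<close> by finite linear combinations of evaluations at points of
  \<open>S\<close>. Applied in both variables of \<open>K\<close>, this exhibits the quadratic forms of \<open>K\<close> on
  \<open>S \<union> {\<gamma>(t)}\<close> as limits of quadratic forms on \<open>S\<close>, so \<open>\<gamma>(t) \<in> S\<close> by maximality. Affine discs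
  in charts then show that the interior of \<open>S\<close> is closed. For a totally real \<open>\<Sigma> \<subseteq> S\<close>, the discs
  \<open>t \<mapsto> v + t w\<close> with \<open>v\<close>, \<open>w\<close> in the real space, evaluated at \<open>t = \<i>\<close>, show that \<open>S\<close> is a neighbourhood
  of each point of \<open>\<Sigma>\<close>.\<close>

section \<open>Newton interpolation of holomorphic functions on a disc\<close>

text \<open>One Newton step passes to \<open>(g z - g (s 0)) / (z - s 0)\<close>. By the maximum principle its supremum
  on the disc of radius 10 is at most \<open>2 / (10 - 1)\<close> times that of \<open>g\<close>, while the factor
  \<open>\<bar>t0 - s 0\<bar>\<close> is at most 2; hence the rate \<open>4/9\<close>.\<close>

lemma newton_interpolation_bound:
  fixes s :: "nat \<Rightarrow> complex" and t0 :: complex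
  assumes "inj s" "\<And>l. norm (s l) \<le> 1" "norm t0 \<le> 1"
  shows "\<exists>a. \<forall>g B. g holomorphic_on ball 0 11 \<longrightarrow> (\<forall>z\<in>cball 0 10. norm (g z) \<le> B) \<longrightarrow>
           norm (g t0 - (\<Sum>l<N. a l * g (s l))) \<le> (4/9)^N * B"
  using assms(1,2)
proof (induction N arbitrary: s)
  case 0
  show ?case using assms(3) by auto
next
  case (Suc N)
  \<comment> \<open>The divided difference at \<open>s 0\<close> is interpolated at the remaining
    nodes, so the induction hypothesis is used for the shifted sequence.\<close>
  have inj: "inj (s \<circ> Suc)"
    using Suc.prems(1) by (simp add: inj_compose)
  have "\<exists>a. \<forall>g B. g holomorphic_on ball 0 11 \<longrightarrow> (\<forall>z\<in>cball 0 10. norm (g z) \<le> B) \<longrightarrow>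
      norm (g t0 - (\<Sum>l<N. a l * g ((s \<circ> Suc) l))) \<le> (4/9)^N * B"
    by (rule Suc.IH[OF inj]) (simp add: Suc.prems(2))
  then obtain a where "\<forall>g B. g holomorphic_on ball 0 11 \<longrightarrow> (\<forall>z\<in>cball 0 10. norm (g z) \<le> B) \<longrightarrow>
      norm (g t0 - (\<Sum>l<N. a l * g ((s \<circ> Suc) l))) \<le> (4/9)^N * B" ..
  then have a: "norm (g t0 - (\<Sum>l<N. a l * g (s (Suc l)))) \<le> (4/9)^N * B"
    if "g holomorphic_on ball 0 11" "\<And>z. z \<in> cball 0 10 \<Longrightarrow> norm (g z) \<le> B" for g B
    using that by simp
  have ne: "s (Suc l) \<noteq> s 0" for l
    using Suc.prems(1) by (auto dest: injD)
  \<comment> \<open>Start from \<open>g t0 = g (s 0) + (t0 - s 0) * G t0\<close>, with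
    \<open>G\<close> the divided difference defined below, interpolate \<open>G t0\<close> at the
    later nodes and collect the multiples of each \<open>g (s l)\<close>. The result involves
    neither \<open>g\<close> nor \<open>B\<close>.\<close>
  define a' where "a' l = (case l of 0 \<Rightarrow> 1 - (\<Sum>l<N. (t0 - s 0) * a l / (s (Suc l) - s 0))
      | Suc l \<Rightarrow> (t0 - s 0) * a l / (s (Suc l) - s 0))" for l
  have "norm (g t0 - (\<Sum>l<Suc N. a' l * g (s l))) \<le> (4/9)^Suc N * B"
    if g: "g holomorphic_on ball 0 11" and B: "\<forall>z\<in>cball 0 10. norm (g z) \<le> B" for g B
  proof -
    define G where "G z = (if z = s 0 then deriv g (s 0) else (g z - g (s 0)) / (z - s 0))" for z
    have s0: "norm (s 0) \<le> 1" using Suc.prems(2) .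
    have B0: "0 \<le> B" using order_trans[OF norm_ge_zero B[rule_format, of 0]] by simp
    have hG: "G holomorphic_on ball 0 11"
      unfolding G_def using pole_lemma_open[OF g open_ball] by simp
    \<comment> \<open>Near \<open>s 0\<close> the denominator is small, so the quotient is estimated
      on the sphere and the maximum principle carries the bound inwards.\<close>
    have sph: "norm (G z) \<le> 2 * B / 9" if "z \<in> sphere 0 10" for z
    proof -
      have n9: "norm (z - s 0) \<ge> 9" using that s0 norm_triangle_ineq2[of z "s 0"] by auto
      then have "z \<noteq> s 0" by auto
      have "norm (g z) \<le> B" "norm (g (s 0)) \<le> B"
        using B that s0 by auto
      then have "norm (g z - g (s 0)) \<le> 2 * B"
        using norm_triangle_ineq4[of "g z" "g (s 0)"] by linarith
      then have "norm (g z - g (s 0)) / norm (z - s 0) \<le> 2 * B / 9"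
        using n9 B0 by (intro frac_le) auto
      then show ?thesis using \<open>z \<noteq> s 0\<close> by (simp add: G_def norm_divide)
    qed
    have bG: "norm (G z) \<le> 2 * B / 9" if "z \<in> cball 0 10" for z
    proof (rule maximum_modulus_frontier[of G "cball 0 10"])
      show "G holomorphic_on interior (cball 0 10)"
        using hG by (rule holomorphic_on_subset) auto
      show "continuous_on (closure (cball 0 10)) G"
        using holomorphic_on_imp_continuous_on[OF hG] by (rule continuous_on_subset) auto
      show "norm (G z) \<le> 2 * B / 9" if "z \<in> frontier (cball 0 10)" for z
        using sph that by (simp add: frontier_cball)
    qed (use that in auto)
    have Gt: "g z = g (s 0) + (z - s 0) * G z" for z
      by (auto simp: G_def)
    have Gs: "G (s (Suc l)) = (g (s (Suc l)) - g (s 0)) / (s (Suc l) - s 0)" for l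
      using ne[of l] by (simp add: G_def)
    have "(\<Sum>l<Suc N. a' l * g (s l)) = a' 0 * g (s 0) + (\<Sum>l<N. (t0 - s 0) * a l / (s (Suc l) - s 0) * g (s (Suc l)))"
      by (simp add: sum.lessThan_Suc_shift a'_def del: sum.lessThan_Suc)
    also have "\<dots> = g (s 0) + (\<Sum>l<N. (t0 - s 0) * a l / (s (Suc l) - s 0) * (g (s (Suc l)) - g (s 0)))"
      by (simp add: a'_def left_diff_distrib right_diff_distrib sum_subtractf sum_distrib_right)
    also have "(\<Sum>l<N. (t0 - s 0) * a l / (s (Suc l) - s 0) * (g (s (Suc l)) - g (s 0)))
       = (t0 - s 0) * (\<Sum>l<N. a l * G (s (Suc l)))"
      unfolding sum_distrib_left by (intro sum.cong) (auto simp: Gs)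
    finally have "g t0 - (\<Sum>l<Suc N. a' l * g (s l)) = (t0 - s 0) * (G t0 - (\<Sum>l<N. a l * G (s (Suc l))))"
      using Gt[of t0] by (simp add: algebra_simps)
    moreover have "norm (t0 - s 0) \<le> 2"
      using norm_triangle_ineq4[of t0 "s 0"] s0 assms(3) by simp
    moreover have "norm (G t0 - (\<Sum>l<N. a l * G (s (Suc l)))) \<le> (4/9)^N * (2 * B / 9)"
      using a[OF hG bG] .
    ultimately have "norm (g t0 - (\<Sum>l<Suc N. a' l * g (s l))) \<le> 2 * ((4/9)^N * (2 * B / 9))"
      by (simp only: norm_mult) (intro mult_mono, auto)
    then show ?thesis by simp
  qed
  then show ?case by blast
qed

section \<open>Adjoining one point of a holomorphic disc\<close>

text \<open>An enumeration of \<open>I\<close> reduces this to the definition. It is needed because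
  interpolation produces quadratic forms indexed by pairs of a point and a node.\<close>

lemma positive_definite_on_finite:
  assumes "positive_definite_on X K" "finite I" "\<And>i. i \<in> I \<Longrightarrow> x i \<in> X"
  shows "(\<Sum>i\<in>I. \<Sum>j\<in>I. c j * cnj (c i) * K (x i, x j)) \<in> \<real>\<^sub>\<ge>\<^sub>0"
proof -
  obtain h where h: "bij_betw h {0..<card I} I"
    using ex_bij_betw_nat_finite[OF assms(2)] by blast
  then have "\<forall>j<card I. (x \<circ> h) j \<in> X"
    using bij_betwE[OF h] assms(3) by simp
  with assms(1) have "(\<Sum>i<card I. \<Sum>j<card I. (c \<circ> h) j * cnj ((c \<circ> h) i) * K ((x \<circ> h) i, (x \<circ> h) j)) \<in> \<real>\<^sub>\<ge>\<^sub>0"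
    unfolding positive_definite_on_def by blast
  then show ?thesis
    by (simp add: sum.reindex_bij_betw[OF h, symmetric] atLeast0LessThan)
qed

text \<open>\<open>K\<close> is antiholomorphic in its second variable, hence the conjugate in
  \<open>hol2\<close>. A form on the enlarged set pairs \<open>\<gamma> t0\<close> with points of
  \<open>S\<close> and with itself, so sections are needed at points of both kinds. Joint continuity
  bounds \<open>K\<close> on a compact bidisc, which controls interpolation in both variables at
  once.\<close>

lemma positive_definite_on_insert_disc:
  fixes K :: "'m \<times> 'm \<Rightarrow> complex" and \<gamma> :: "complex \<Rightarrow> 'm"
  assumes pd: "positive_definite_on S K"
    and hol1: "\<And>x. x \<in> S \<union> \<gamma> ` ball 0 11 \<Longrightarrow> (\<lambda>t. K (\<gamma> t, x)) holomorphic_on ball 0 11"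
    and hol2: "\<And>x. x \<in> S \<union> \<gamma> ` ball 0 11 \<Longrightarrow> (\<lambda>t. cnj (K (x, \<gamma> t))) holomorphic_on ball 0 11"
    and cont: "continuous_on (ball 0 11 \<times> ball 0 11) (\<lambda>(p, q). K (\<gamma> p, \<gamma> q))"
    and s: "inj s" "\<And>l::nat. norm (s l) \<le> 1" "\<And>l. \<gamma> (s l) \<in> S"
    and t0: "norm t0 \<le> 1"
  shows "positive_definite_on (insert (\<gamma> t0) S) K"
proof -
  \<comment> \<open>With \<open>Suc N\<close> nodes the node 0 always occurs; it will carry the
    weight of the points that are not replaced. The coefficients precede \<open>g\<close>, so one
    family serves both variables and also functions that vary with \<open>N\<close>.\<close>
  have "\<forall>N. \<exists>a. \<forall>g B. g holomorphic_on ball 0 11 \<longrightarrow> (\<forall>z\<in>cball 0 10. norm (g z) \<le> B) \<longrightarrow>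
           norm (g t0 - (\<Sum>l<Suc N. a l * g (s l))) \<le> (4/9)^Suc N * B"
    using newton_interpolation_bound[OF s(1,2) t0] by blast
  then obtain a where a: "\<And>N g B. \<lbrakk>g holomorphic_on ball 0 11; \<And>z. z \<in> cball 0 10 \<Longrightarrow> norm (g z) \<le> B\<rbrakk> \<Longrightarrow>
           norm (g t0 - (\<Sum>l<Suc N. a N l * g (s l))) \<le> (4/9)^Suc N * B"
    by metis
  have pow0: "(\<lambda>N. (4/9::real)^Suc N * B) \<longlonglongrightarrow> 0" for B
  proof -
    have "(\<lambda>N. (4/9::real)^N) \<longlonglongrightarrow> 0" by (rule LIMSEQ_realpow_zero) auto
    then have "(\<lambda>N. (4/9::real)^Suc N) \<longlonglongrightarrow> 0" by (rule LIMSEQ_Suc)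
    then show ?thesis using tendsto_mult_left_zero by blast
  qed
  have lim1: "(\<lambda>N. \<Sum>l<Suc N. a N l * g (s l)) \<longlonglongrightarrow> g t0" if g: "g holomorphic_on ball 0 11" for g
  proof -
    have "continuous_on (cball 0 10) g"
      using holomorphic_on_imp_continuous_on[OF g] by (rule continuous_on_subset) auto
    then have "bounded (g ` cball 0 10)"
      by (intro compact_imp_bounded compact_continuous_image) auto
    then obtain B where B: "\<And>z. z \<in> cball 0 10 \<Longrightarrow> norm (g z) \<le> B"
      unfolding bounded_iff by blast
    have "(\<lambda>N. (\<Sum>l<Suc N. a N l * g (s l)) - g t0) \<longlonglongrightarrow> 0"
      by (rule Lim_null_comparison[OF _ pow0[of B]])
         (use a[OF g B] in \<open>auto simp: norm_minus_commute\<close>)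
    then show ?thesis by (simp add: LIM_zero_iff)
  qed
  define H where "H p q = K (\<gamma> p, \<gamma> q)" for p q
  have H1: "(\<lambda>p. H p q) holomorphic_on ball 0 11" if "q \<in> ball 0 11" for q
    unfolding H_def using that by (intro hol1) auto
  have H2: "(\<lambda>q. cnj (H p q)) holomorphic_on ball 0 11" if "p \<in> ball 0 11" for p
    unfolding H_def using that by (intro hol2) auto
  have sb: "s l \<in> ball 0 11" for l using s(2)[of l] by simp
  have tb: "t0 \<in> ball 0 11" using t0 by simp
  have lim2: "(\<lambda>N. \<Sum>l<Suc N. \<Sum>m<Suc N. a N l * cnj (a N m) * H (s l) (s m)) \<longlonglongrightarrow> H t0 t0"
  proof -
    have "continuous_on (cball 0 10 \<times> cball 0 10) (\<lambda>(p, q). H p q)"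
      unfolding H_def using cont by (rule continuous_on_subset) auto
    then have "bounded ((\<lambda>(p, q). H p q) ` (cball 0 10 \<times> cball 0 10))"
      by (intro compact_imp_bounded compact_continuous_image compact_Times) auto
    then obtain B where B: "\<And>p q. p \<in> cball 0 10 \<Longrightarrow> q \<in> cball 0 10 \<Longrightarrow> norm (H p q) \<le> B"
      unfolding bounded_iff by fastforce
    have B0: "0 \<le> B" using order_trans[OF norm_ge_zero B[of 0 0]] by simp
    \<comment> \<open>\<open>G N\<close> is the error of interpolating in the second variable.
      Interpolating \<open>H p t0\<close> in \<open>p\<close> and subtracting the same combination
      of values of \<open>G N\<close> leaves exactly the double sum, so it remains to show that this
      combination tends to 0.\<close>
    define G where "G N p = H p t0 - (\<Sum>m<Suc N. cnj (a N m) * H p (s m))" for N p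
    have hG: "G N holomorphic_on ball 0 11" for N
      unfolding G_def by (intro holomorphic_intros H1 sb tb)
    have bG: "norm (G N p) \<le> (4/9)^Suc N * B" if "p \<in> cball 0 10" for N p
    proof -
      \<comment> \<open>Interpolation applies to the holomorphic function \<open>cnj (H p q)\<close>
        of \<open>q\<close>; this is why the second variable carries the conjugate
        coefficients.\<close>
      have "norm (cnj (H p t0) - (\<Sum>m<Suc N. a N m * cnj (H p (s m)))) \<le> (4/9)^Suc N * B"
        by (rule a) (use H2 that B in auto)
      also have "cnj (H p t0) - (\<Sum>m<Suc N. a N m * cnj (H p (s m))) = cnj (G N p)"
        by (simp add: G_def)
      finally show ?thesis by simp
    qed
    \<comment> \<open>No bound on the coefficients \<open>a N l\<close> is available, so the sum is
      not estimated term by term. It is compared with \<open>G N t0\<close> by interpolating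
      \<open>G N\<close> once more; both the value and the error are small.\<close>
    have "norm (\<Sum>l<Suc N. a N l * G N (s l)) \<le> (4/9)^Suc N * (2 * B)" for N
    proof -
      have "norm (G N t0 - (\<Sum>l<Suc N. a N l * G N (s l))) \<le> (4/9)^Suc N * ((4/9)^Suc N * B)"
        by (rule a[OF hG bG])
      also have "\<dots> \<le> 1 * ((4/9)^Suc N * B)"
        using B0 by (intro mult_right_mono power_le_one) auto
      finally have "norm (G N t0 - (\<Sum>l<Suc N. a N l * G N (s l))) \<le> (4/9)^Suc N * B" by simp
      moreover have "norm (G N t0) \<le> (4/9)^Suc N * B" using bG t0 by simp
      moreover have "norm (\<Sum>l<Suc N. a N l * G N (s l)) \<le>
          norm (G N t0) + norm (G N t0 - (\<Sum>l<Suc N. a N l * G N (s l)))"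
        using norm_triangle_ineq4[of "G N t0" "G N t0 - (\<Sum>l<Suc N. a N l * G N (s l))"]
        by (simp only: diff_diff_eq2 add_diff_cancel_left')
      ultimately show ?thesis by simp
    qed
    then have "(\<lambda>N. \<Sum>l<Suc N. a N l * G N (s l)) \<longlonglongrightarrow> 0"
      by (intro Lim_null_comparison[OF _ pow0[of "2 * B"]] always_eventually) blast
    with lim1[OF H1[OF tb]]
    have "(\<lambda>N. (\<Sum>l<Suc N. a N l * H (s l) t0) - (\<Sum>l<Suc N. a N l * G N (s l))) \<longlonglongrightarrow> H t0 t0 - 0"
      by (rule tendsto_diff)
    moreover have "(\<Sum>l<Suc N. a N l * H (s l) t0) - (\<Sum>l<Suc N. a N l * G N (s l)) =
      (\<Sum>l<Suc N. \<Sum>m<Suc N. a N l * cnj (a N m) * H (s l) (s m))" for N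
      by (simp only: sum_subtractf[symmetric] G_def right_diff_distrib sum_distrib_left mult.assoc) simp
    ultimately show ?thesis by simp
  qed
  show ?thesis
    unfolding positive_definite_on_def
  proof (intro allI impI)
    fix m :: nat and x :: "nat \<Rightarrow> 'm" and c :: "nat \<Rightarrow> complex"
    assume x: "\<forall>j<m. x j \<in> insert (\<gamma> t0) S"
    \<comment> \<open>Each occurrence of \<open>\<gamma> t0\<close> among the \<open>x j\<close> is replaced by its interpolating combination of the
      points \<open>\<gamma> (s l)\<close>; the other points are kept, with all their weight on \<open>l = 0\<close>.\<close>
    define \<alpha> where "\<alpha> N j l = (if x j = \<gamma> t0 then a N l else if l = 0 then 1 else 0)" for N j and l :: nat
    define p where "p j l = (if x j = \<gamma> t0 then \<gamma> (s l) else x j)" for j l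
    have pS: "p j l \<in> S" if "j < m" for j l
      using x that s(3) by (auto simp: p_def)
    define T where "T N j k = (\<Sum>l<Suc N. \<Sum>n<Suc N. \<alpha> N j l * cnj (\<alpha> N k n) * K (p j l, p k n))" for N j k
    have one: "(\<Sum>l<Suc N. (if l = 0 then 1 else 0) * f l) = f 0" for N and f :: "nat \<Rightarrow> complex"
      by (subst sum.lessThan_Suc_shift) simp
    have T: "(\<lambda>N. T N j k) \<longlonglongrightarrow> K (x j, x k)" if "j < m" "k < m" for j k
    proof -
      \<comment> \<open>A point other than \<open>\<gamma> t0\<close> collapses its sum to the node
        0. What remains is interpolation in both variables, in the first, in the second
        (conjugated), or in none.\<close>
      consider "x j = \<gamma> t0" "x k = \<gamma> t0" | "x j = \<gamma> t0" "x k \<noteq> \<gamma> t0"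
        | "x j \<noteq> \<gamma> t0" "x k = \<gamma> t0" | "x j \<noteq> \<gamma> t0" "x k \<noteq> \<gamma> t0" by blast
      then show ?thesis
      proof cases
        case 1
        then show ?thesis using lim2 by (simp add: T_def \<alpha>_def p_def H_def)
      next
        case 2
        then have "T N j k = (\<Sum>l<Suc N. a N l * K (\<gamma> (s l), x k))" for N
          unfolding T_def by (simp add: \<alpha>_def p_def sum.lessThan_Suc_shift del: sum.lessThan_Suc)
        moreover have "(\<lambda>t. K (\<gamma> t, x k)) holomorphic_on ball 0 11"
          using 2 x that by (intro hol1) auto
        ultimately show ?thesis using lim1 2 by simp
      next
        case 3
        then have "T N j k = cnj (\<Sum>l<Suc N. a N l * cnj (K (x j, \<gamma> (s l))))" for N
          unfolding T_def by (simp add: \<alpha>_def p_def sum.lessThan_Suc_shift del: sum.lessThan_Suc)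
        moreover have "(\<lambda>t. cnj (K (x j, \<gamma> t))) holomorphic_on ball 0 11"
          using 3 x that by (intro hol2) auto
        then have "(\<lambda>N. cnj (\<Sum>l<Suc N. a N l * cnj (K (x j, \<gamma> (s l))))) \<longlonglongrightarrow> cnj (cnj (K (x j, \<gamma> t0)))"
          by (intro tendsto_cnj lim1)
        ultimately show ?thesis using 3 by simp
      next
        case 4
        then have "T N j k = K (x j, x k)" for N
          unfolding T_def by (simp add: \<alpha>_def p_def sum.lessThan_Suc_shift del: sum.lessThan_Suc)
        then show ?thesis by simp
      qed
    qed
    have nonneg: "(\<Sum>j<m. \<Sum>k<m. c k * cnj (c j) * T N j k) \<in> \<real>\<^sub>\<ge>\<^sub>0" for N
    proof -
      \<comment> \<open>Expanded, the form with \<open>T\<close> is a quadratic form of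
        \<open>K\<close> at the points \<open>p j l\<close> of \<open>S\<close>, indexed by the
        pairs \<open>(j, l)\<close>, with weights \<open>c j * cnj (\<alpha> N j l)\<close>.\<close>
      have "(\<Sum>u\<in>{..<m} \<times> {..<Suc N}. \<Sum>v\<in>{..<m} \<times> {..<Suc N}.
          (case v of (k, n) \<Rightarrow> c k * cnj (\<alpha> N k n)) * cnj (case u of (j, l) \<Rightarrow> c j * cnj (\<alpha> N j l)) *
          K (case_prod p u, case_prod p v)) \<in> \<real>\<^sub>\<ge>\<^sub>0"
        by (rule positive_definite_on_finite[OF pd]) (auto simp: pS)
      also have "(\<Sum>u\<in>{..<m} \<times> {..<Suc N}. \<Sum>v\<in>{..<m} \<times> {..<Suc N}.
          (case v of (k, n) \<Rightarrow> c k * cnj (\<alpha> N k n)) * cnj (case u of (j, l) \<Rightarrow> c j * cnj (\<alpha> N j l)) *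
          K (case_prod p u, case_prod p v)) =
        (\<Sum>j<m. \<Sum>l<Suc N. \<Sum>k<m. \<Sum>n<Suc N. c k * cnj (c j) * (\<alpha> N j l * cnj (\<alpha> N k n) * K (p j l, p k n)))"
        by (simp only: sum.cartesian_product' split_beta fst_conv snd_conv complex_cnj_mult complex_cnj_cnj mult_ac)
      also have "\<dots> = (\<Sum>j<m. \<Sum>k<m. \<Sum>l<Suc N. \<Sum>n<Suc N. c k * cnj (c j) * (\<alpha> N j l * cnj (\<alpha> N k n) * K (p j l, p k n)))"
        by (intro sum.cong refl sum.swap)
      also have "\<dots> = (\<Sum>j<m. \<Sum>k<m. c k * cnj (c j) * T N j k)"
        by (simp only: T_def sum_distrib_left)
      finally show ?thesis .
    qed
    have "(\<lambda>N. \<Sum>j<m. \<Sum>k<m. c k * cnj (c j) * T N j k) \<longlonglongrightarrow> (\<Sum>j<m. \<Sum>k<m. c k * cnj (c j) * K (x j, x k))"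
      by (intro tendsto_sum tendsto_mult_left T) auto
    then show "(\<Sum>j<m. \<Sum>k<m. c k * cnj (c j) * K (x j, x k)) \<in> \<real>\<^sub>\<ge>\<^sub>0"
      by (rule Lim_in_closed_set[OF closed_nonneg_Reals_complex always_eventually sequentially_bot, rotated])
         (use nonneg in blast)
  qed
qed

section \<open>Arithmetic and continuity in topological vector spaces\<close>

lemma is_vector_spaceD:
  assumes "is_vector_space E"
  shows "0 \<in> vcarrier E"
    and "x \<in> vcarrier E \<Longrightarrow> y \<in> vcarrier E \<Longrightarrow> x + y \<in> vcarrier E"
    and "x \<in> vcarrier E \<Longrightarrow> vscale E c x \<in> vcarrier E"
    and "x \<in> vcarrier E \<Longrightarrow> y \<in> vcarrier E \<Longrightarrow> vscale E c (x + y) = vscale E c x + vscale E c y"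
    and "x \<in> vcarrier E \<Longrightarrow> vscale E (c + d) x = vscale E c x + vscale E d x"
    and "x \<in> vcarrier E \<Longrightarrow> vscale E (c * d) x = vscale E c (vscale E d x)"
    and "x \<in> vcarrier E \<Longrightarrow> vscale E 1 x = x"
  using assms unfolding is_vector_space_def by blast+

lemma vscale_zero_left:
  assumes "is_vector_space E" "x \<in> vcarrier E"
  shows "vscale E 0 x = 0"
  using is_vector_spaceD(5)[OF assms, of 0 0] by simp

lemma vscale_zero_right:
  assumes "is_vector_space E"
  shows "vscale E c 0 = 0"
  using is_vector_spaceD(4)[OF assms, of 0 0 c] is_vector_spaceD(1)[OF assms] by simp

lemma vscale_minus_one:
  assumes "is_vector_space E" "x \<in> vcarrier E"
  shows "vscale E (- 1) x = - x"
  using is_vector_spaceD(5)[OF assms, of "-1" 1] is_vector_spaceD(7)[OF assms] vscale_zero_left[OF assms]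
  by (simp add: eq_neg_iff_add_eq_0)

text \<open>Negation comes from the ambient group, and closure of the carrier under it is not among
  the axioms; it follows because negation is scaling by \<open>- 1\<close>.\<close>

lemma vcarrier_minus:
  assumes "is_vector_space E" "x \<in> vcarrier E" "y \<in> vcarrier E"
  shows "x - y \<in> vcarrier E"
  using is_vector_spaceD(2)[OF assms(1,2)] is_vector_spaceD(3)[OF assms(1,3), of "-1"]
  by (metis assms(1,3) diff_conv_add_uminus vscale_minus_one)

lemma is_tvsD:
  assumes "is_tvs E"
  shows "is_vector_space E"
    and "continuous_map (prod_topology (vtop E) (vtop E)) (vtop E) (\<lambda>(x, y). x + y)"
    and "continuous_map (prod_topology euclidean (vtop E)) (vtop E) (\<lambda>(c, x). vscale E c x)"
  using assms unfolding is_tvs_def by blast+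

lemma continuous_map_vadd:
  assumes "is_tvs E" "continuous_map X (vtop E) f" "continuous_map X (vtop E) g"
  shows "continuous_map X (vtop E) (\<lambda>x. f x + g x)"
  using continuous_map_compose[OF continuous_map_pairedI[OF assms(2,3)] is_tvsD(2)[OF assms(1)]]
  by (simp add: o_def)

lemma continuous_map_vscale:
  assumes "is_tvs E" "continuous_map X euclidean f" "continuous_map X (vtop E) g"
  shows "continuous_map X (vtop E) (\<lambda>x. vscale E (f x) (g x))"
  using continuous_map_compose[OF continuous_map_pairedI[OF assms(2,3)] is_tvsD(3)[OF assms(1)]]
  by (simp add: o_def)

lemma continuous_map_vminus:
  assumes "is_tvs E" "continuous_map X (vtop E) f" "continuous_map X (vtop E) g"
  shows "continuous_map X (vtop E) (\<lambda>x. f x - g x)"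
proof (rule continuous_map_eq)
  show "continuous_map X (vtop E) (\<lambda>x. f x + vscale E (- 1) (g x))"
    by (intro continuous_map_vadd[OF assms(1)] continuous_map_vscale[OF assms(1)] assms) simp
next
  fix x assume "x \<in> topspace X"
  then have "g x \<in> vcarrier E" using assms(3) by (auto simp: continuous_map_def)
  then show "f x + vscale E (- 1) (g x) = f x - g x"
    using vscale_minus_one[OF is_tvsD(1)[OF assms(1)]] by simp
qed

lemma open_affine_preimage:
  assumes E: "is_tvs E" and "openin (vtop E) A" "x \<in> vcarrier E" "v \<in> vcarrier E"
  shows "open {t. x + vscale E t v \<in> A}"
proof -
  have "continuous_map euclidean (vtop E) (\<lambda>t. x + vscale E t v)"
    by (intro continuous_map_vadd[OF E] continuous_map_vscale[OF E]) (use assms in auto)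
  from openin_continuous_map_preimage[OF this assms(2)] show ?thesis by simp
qed

section \<open>Holomorphic maps: sections and derivatives along curves\<close>

text \<open>The difference quotients at \<open>x\<close> also evaluate the maps away from
  \<open>x\<close>, but \<open>A\<close> is open, so for small \<open>t\<close> they see only points
  of \<open>A\<close>.\<close>

lemma holo_on_cong:
  assumes E: "is_tvs E" and f: "holo_on E F A f" and eq: "\<And>x. x \<in> A \<Longrightarrow> f x = g x"
  shows "holo_on E F A g"
proof -
  have A: "openin (vtop E) A" using f by (simp add: holo_on_def)
  then have sub: "A \<subseteq> vcarrier E" by (rule openin_subset)
  obtain df where df: "\<And>x v. x \<in> A \<Longrightarrow> v \<in> vcarrier E \<Longrightarrow>
      limitin (vtop F) (\<lambda>t. vscale F (inverse t) (f (x + vscale E t v) - f x)) (df (x, v)) (at 0)"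
    and cdf: "continuous_map (prod_topology (subtopology (vtop E) A) (vtop E)) (vtop F) df"
    using f unfolding holo_on_def by blast
  have "limitin (vtop F) (\<lambda>t. vscale F (inverse t) (g (x + vscale E t v) - g x)) (df (x, v)) (at 0)"
    if x: "x \<in> A" and v: "v \<in> vcarrier E" for x v
  proof -
    have "0 \<in> {t. x + vscale E t v \<in> A}"
      using vscale_zero_left[OF is_tvsD(1)[OF E] v] x by simp
    moreover have "open {t. x + vscale E t v \<in> A}"
      using open_affine_preimage[OF E A _ v] x sub by blast
    ultimately have "\<forall>\<^sub>F t in at 0. x + vscale E t v \<in> A"
      using eventually_at_topological by blast
    then have "\<forall>\<^sub>F t in at 0. vscale F (inverse t) (f (x + vscale E t v) - f x) =
        vscale F (inverse t) (g (x + vscale E t v) - g x)"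
      by eventually_elim (simp add: eq x)
    then show ?thesis using df[OF x v] by (rule limitin_transform_eventually)
  qed
  moreover have "continuous_map (subtopology (vtop E) A) (vtop F) g"
    by (rule continuous_map_eq[of _ _ f]) (use f eq in \<open>auto simp: holo_on_def\<close>)
  ultimately show ?thesis
    unfolding holo_on_def using A cdf by blast
qed

text \<open>The derivative of the section in direction \<open>v\<close> is that of \<open>g\<close>
  in direction \<open>(v, 0)\<close>. Since \<open>B\<close> contains \<open>y\<close>, openness of
  the product passes to \<open>A\<close>.\<close>

lemma holo_on_section1:
  assumes F: "is_vector_space F" and g: "holo_on (prod_tvs E F) complex_line (A \<times> B) g"
    and B: "openin (vtop F) B" and y: "y \<in> B"
  shows "holo_on E complex_line A (\<lambda>x. g (x, y))"
proof -
  have AB: "openin (prod_topology (vtop E) (vtop F)) (A \<times> B)"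
    using g by (simp add: holo_on_def prod_tvs_def)
  have A: "openin (vtop E) A"
    using AB y by (cases "A = {}") (auto simp: openin_prod_Times_iff)
  have yF: "y \<in> vcarrier F" using openin_subset[OF B] y by blast
  obtain df where df: "\<And>x v. x \<in> A \<times> B \<Longrightarrow> v \<in> vcarrier (prod_tvs E F) \<Longrightarrow>
      ((\<lambda>t. inverse t * (g (x + vscale (prod_tvs E F) t v) - g x)) \<longlongrightarrow> df (x, v)) (at 0)"
    and cdf: "continuous_map (prod_topology (subtopology (vtop (prod_tvs E F)) (A \<times> B)) (vtop (prod_tvs E F))) euclidean df"
    using g unfolding holo_on_def complex_line_def by auto
  have c: "continuous_map (subtopology (vtop E) A) (subtopology (vtop (prod_tvs E F)) (A \<times> B)) (\<lambda>x. (x, y))"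
    by (auto simp: prod_tvs_def continuous_map_in_subtopology y yF intro!: continuous_map_pairedI continuous_map_from_subtopology)
  have "continuous_map (prod_topology (subtopology (vtop E) A) (vtop E))
     (prod_topology (subtopology (vtop (prod_tvs E F)) (A \<times> B)) (vtop (prod_tvs E F))) (\<lambda>(x, v). ((x, y), (v, 0)))"
    unfolding case_prod_unfold
    by (intro continuous_map_pairedI continuous_map_compose[OF continuous_map_fst c, unfolded o_def])
       (auto simp: prod_tvs_def is_vector_spaceD(1)[OF F] intro!: continuous_map_pairedI continuous_map_snd)
  from continuous_map_compose[OF this cdf]
  have "continuous_map (prod_topology (subtopology (vtop E) A) (vtop E)) euclidean (\<lambda>(x, v). df ((x, y), (v, 0)))"
    by (simp add: o_def case_prod_unfold)
  moreover have "continuous_map (subtopology (vtop E) A) euclidean (\<lambda>x. g (x, y))"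
    using continuous_map_compose[OF c, of euclidean g] g by (simp add: holo_on_def complex_line_def o_def)
  moreover have "((\<lambda>t. inverse t * (g (x + vscale E t v, y) - g (x, y))) \<longlongrightarrow> df ((x, y), (v, 0))) (at 0)"
    if "x \<in> A" "v \<in> vcarrier E" for x v
    using df[of "(x, y)" "(v, 0)"] that y vscale_zero_right[OF F] is_vector_spaceD(1)[OF F]
    by (simp add: prod_tvs_def)
  ultimately show ?thesis
    using A unfolding holo_on_def complex_line_def
    by (auto intro!: exI[of _ "\<lambda>(x, v). df ((x, y), (v, 0))"])
qed

text \<open>A scalar \<open>t\<close> acts on the conjugate space as \<open>cnj t\<close>.
  Conjugating the values and substituting \<open>cnj t\<close> for \<open>t\<close> in the
  difference quotient undoes this, so the result is holomorphic for the original structure of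
  \<open>F\<close>.\<close>

lemma holo_on_section2:
  assumes E: "is_vector_space E" and g: "holo_on (prod_tvs E (conj_tvs F)) complex_line (A \<times> B) g"
    and A: "openin (vtop E) A" and x: "x \<in> A"
  shows "holo_on F complex_line B (\<lambda>y. cnj (g (x, y)))"
proof -
  let ?P = "prod_tvs E (conj_tvs F)"
  have AB: "openin (prod_topology (vtop E) (vtop F)) (A \<times> B)"
    using g by (simp add: holo_on_def prod_tvs_def conj_tvs_def)
  have B: "openin (vtop F) B"
    using AB x by (cases "B = {}") (auto simp: openin_prod_Times_iff)
  have xE: "x \<in> vcarrier E" using openin_subset[OF A] x by blast
  obtain df where df: "\<And>x v. x \<in> A \<times> B \<Longrightarrow> v \<in> vcarrier ?P \<Longrightarrow>
      ((\<lambda>t. inverse t * (g (x + vscale ?P t v) - g x)) \<longlongrightarrow> df (x, v)) (at 0)"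
    and cdf: "continuous_map (prod_topology (subtopology (vtop ?P) (A \<times> B)) (vtop ?P)) euclidean df"
    using g unfolding holo_on_def complex_line_def by auto
  have c: "continuous_map (subtopology (vtop F) B) (subtopology (vtop ?P) (A \<times> B)) (\<lambda>y. (x, y))"
    by (auto simp: prod_tvs_def conj_tvs_def continuous_map_in_subtopology x xE intro!: continuous_map_pairedI continuous_map_from_subtopology)
  have cnj: "continuous_map euclidean euclidean cnj"
    by (simp add: continuous_on_cnj continuous_on_id)
  have "continuous_map (prod_topology (subtopology (vtop F) B) (vtop F))
     (prod_topology (subtopology (vtop ?P) (A \<times> B)) (vtop ?P)) (\<lambda>(y, v). ((x, y), (0, v)))"
    unfolding case_prod_unfold
    by (intro continuous_map_pairedI continuous_map_compose[OF continuous_map_fst c, unfolded o_def])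
       (auto simp: prod_tvs_def conj_tvs_def is_vector_spaceD(1)[OF E] intro!: continuous_map_pairedI continuous_map_snd)
  from continuous_map_compose[OF continuous_map_compose[OF this cdf] cnj]
  have "continuous_map (prod_topology (subtopology (vtop F) B) (vtop F)) euclidean (\<lambda>(y, v). cnj (df ((x, y), (0, v))))"
    by (simp add: o_def case_prod_unfold)
  moreover have "continuous_map (subtopology (vtop F) B) euclidean (\<lambda>y. cnj (g (x, y)))"
    using continuous_map_compose[OF continuous_map_compose[OF c] cnj, of g] g
    by (simp add: holo_on_def complex_line_def o_def)
  moreover have "((\<lambda>t. inverse t * (cnj (g (x, y + vscale F t v)) - cnj (g (x, y)))) \<longlongrightarrow> cnj (df ((x, y), (0, v)))) (at 0)"
    if "y \<in> B" "v \<in> vcarrier F" for y v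
  proof -
    have 1: "((\<lambda>t. inverse t * (g (x, y + vscale F (cnj t) v) - g (x, y))) \<longlongrightarrow> df ((x, y), (0, v))) (at 0)"
      using df[of "(x, y)" "(0, v)"] that x vscale_zero_right[OF E] is_vector_spaceD(1)[OF E]
      by (simp add: prod_tvs_def conj_tvs_def)
    \<comment> \<open>Conjugation preserves punctured neighbourhoods of 0, which justifies the
      substitution of \<open>cnj t\<close> for \<open>t\<close>.\<close>
    have "filterlim cnj (at 0) (at (0::complex))"
      unfolding filterlim_at by (auto intro!: tendsto_eq_intros eventually_at_topological[THEN iffD2] exI[of _ UNIV])
    from tendsto_cnj[OF filterlim_compose[OF 1 this]]
    show ?thesis by simp
  qed
  ultimately show ?thesis
    using B unfolding holo_on_def complex_line_def
    by (auto intro!: exI[of _ "\<lambda>(y, v). cnj (df ((x, y), (0, v)))"])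
qed

text \<open>Differentiates \<open>f\<close> along a curve known only to have velocity
  \<open>w\<close> at 0, as when an affine disc of one chart is read in another. The secant
  direction varies with \<open>t\<close>; joint continuity of \<open>df\<close> in point and
  direction compensates for this.\<close>

lemma holo_on_chain_rule:
  assumes E: "is_tvs E" and f: "holo_on E complex_line A f" and x: "x \<in> A"
    and c: "\<forall>\<^sub>F t in at 0. c t \<in> vcarrier E"
    and lim: "limitin (vtop E) (\<lambda>t. vscale E (inverse t) (c t - x)) w (at (0::complex))"
  shows "\<exists>D. ((\<lambda>t. (f (c t) - f x) / t) \<longlongrightarrow> D) (at 0)"
proof -
  note V = is_tvsD(1)[OF E]
  have A: "openin (vtop E) A" using f by (simp add: holo_on_def)
  then have sub: "A \<subseteq> vcarrier E" by (rule openin_subset)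
  then have xE: "x \<in> vcarrier E" using x by blast
  have wE: "w \<in> vcarrier E" using lim by (rule limitin_topspace)
  obtain df where df: "\<And>x v. x \<in> A \<Longrightarrow> v \<in> vcarrier E \<Longrightarrow>
      ((\<lambda>t. inverse t * (f (x + vscale E t v) - f x)) \<longlongrightarrow> df (x, v)) (at 0)"
    and cdf: "continuous_map (prod_topology (subtopology (vtop E) A) (vtop E)) euclidean df"
    using f unfolding holo_on_def complex_line_def by auto
  have deriv: "((\<lambda>\<sigma>. f (x + vscale E \<sigma> v)) has_field_derivative df (x + vscale E \<sigma> v, v)) (at \<sigma>)"
    if "v \<in> vcarrier E" "x + vscale E \<sigma> v \<in> A" for \<sigma> v
    using df[OF that(2,1)] is_vector_spaceD(5)[OF V that(1)]
    by (simp add: DERIV_def add.assoc divide_inverse mult.commute)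
  \<comment> \<open>With \<open>v = (c t - x) / t\<close>, a mean value estimate for \<open>\<sigma> \<mapsto> f (x + \<sigma> v) - \<sigma> df (x, w)\<close>.\<close>
  have key: "\<forall>\<^sub>F t in at 0. norm ((f (c t) - f x) / t - df (x, w)) < e" if "e > 0" for e
  proof -
    \<comment> \<open>The pairs of a point of \<open>A\<close> and a direction at which
      \<open>df\<close> is \<open>e/2\<close>-close to \<open>df (x, w)\<close>. Pulling this open
      set back along \<open>(\<sigma>, v)\<close> to \<open>(x + \<sigma> v, v)\<close> gives a box
      around \<open>(0, w)\<close> on which one estimate holds for all secant directions.\<close>
    define O' where "O' = {z \<in> topspace (prod_topology (subtopology (vtop E) A) (vtop E)). df z \<in> ball (df (x, w)) (e/2)}"
    have "openin (prod_topology (subtopology (vtop E) A) (vtop E)) O'"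
      unfolding O'_def by (rule openin_continuous_map_preimage[OF cdf]) simp
    moreover have "prod_topology (subtopology (vtop E) A) (vtop E) = subtopology (prod_topology (vtop E) (vtop E)) (A \<times> vcarrier E)"
      by (simp add: prod_topology_subtopology(1))
    moreover have "openin (prod_topology (vtop E) (vtop E)) (A \<times> vcarrier E)"
      by (simp add: openin_prod_Times_iff A)
    ultimately have O': "openin (prod_topology (vtop E) (vtop E)) O'"
      by (metis openin_trans_full)
    have "continuous_map (prod_topology euclidean (vtop E)) (prod_topology (vtop E) (vtop E)) (\<lambda>(\<sigma>, v). (x + vscale E \<sigma> v, v))"
      unfolding case_prod_unfold
      by (intro continuous_map_pairedI continuous_map_vadd[OF E] continuous_map_vscale[OF E] continuous_map_fst continuous_map_snd)
         (simp add: xE)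
    from openin_continuous_map_preimage[OF this O']
    have "openin (prod_topology euclidean (vtop E)) {z \<in> topspace (prod_topology euclidean (vtop E)). (case z of (\<sigma>, v) \<Rightarrow> (x + vscale E \<sigma> v, v)) \<in> O'}" .
    moreover have "(0, w) \<in> {z \<in> topspace (prod_topology euclidean (vtop E)). (case z of (\<sigma>, v) \<Rightarrow> (x + vscale E \<sigma> v, v)) \<in> O'}"
      using x xE wE that vscale_zero_left[OF V wE] by (simp add: O'_def)
    ultimately obtain S N where S: "openin euclidean S" "openin (vtop E) N" "0 \<in> S" "w \<in> N"
        "S \<times> N \<subseteq> {z \<in> topspace (prod_topology euclidean (vtop E)). (case z of (\<sigma>, v) \<Rightarrow> (x + vscale E \<sigma> v, v)) \<in> O'}"
      unfolding openin_prod_topology_alt by meson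
    then obtain \<delta> where \<delta>: "\<delta> > 0" "ball 0 \<delta> \<subseteq> S" by (metis open_contains_ball open_openin)
    have in_O: "(x + vscale E \<sigma> v, v) \<in> O'" if "norm \<sigma> < \<delta>" "v \<in> N" for \<sigma> v
      using S(5) \<delta>(2) that by fastforce
    have est: "norm ((f (x + vscale E t v) - f x) / t - df (x, w)) < e"
      if t: "norm t < \<delta>" "t \<noteq> 0" and v: "v \<in> N" for t v
    proof -
      have vE: "v \<in> vcarrier E" using v S(2) openin_subset by blast
      have inA: "x + vscale E \<sigma> v \<in> A" "norm (df (x + vscale E \<sigma> v, v) - df (x, w)) \<le> e/2" if "norm \<sigma> < \<delta>" for \<sigma>
        using in_O[OF that v] by (auto simp: O'_def dist_norm norm_minus_commute)
      have "norm ((f (x + vscale E t v) - t * df (x, w)) - (f (x + vscale E 0 v) - 0 * df (x, w))) \<le> e/2 * norm (t - 0)"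
      proof (rule field_differentiable_bound[of "ball 0 \<delta>" "\<lambda>\<sigma>. f (x + vscale E \<sigma> v) - \<sigma> * df (x, w)" "\<lambda>\<sigma>. df (x + vscale E \<sigma> v, v) - df (x, w)"])
        show "((\<lambda>\<sigma>. f (x + vscale E \<sigma> v) - \<sigma> * df (x, w)) has_field_derivative df (x + vscale E \<sigma> v, v) - df (x, w)) (at \<sigma> within ball 0 \<delta>)"
          if "\<sigma> \<in> ball 0 \<delta>" for \<sigma>
          using that by (auto intro!: derivative_eq_intros has_field_derivative_at_within[OF deriv] vE inA)
      qed (use t \<delta> inA in auto)
      then have "norm (f (x + vscale E t v) - f x - t * df (x, w)) \<le> e/2 * norm t"
        using vscale_zero_left[OF V vE] by (simp add: algebra_simps)
      moreover have "(f (x + vscale E t v) - f x) / t - df (x, w) = (f (x + vscale E t v) - f x - t * df (x, w)) / t"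
        using t(2) by (simp add: field_simps)
      ultimately have "norm ((f (x + vscale E t v) - f x) / t - df (x, w)) \<le> e/2"
        using t(2) by (simp add: norm_divide divide_le_eq)
      then show ?thesis using \<open>e > 0\<close> by simp
    qed
    have "\<forall>\<^sub>F t in at 0. vscale E (inverse t) (c t - x) \<in> N"
      using lim S by (simp add: limitin_def)
    moreover have "\<forall>\<^sub>F t in at (0::complex). norm t < \<delta> \<and> t \<noteq> 0"
      using \<delta>(1) by (auto simp: eventually_at dist_norm)
    ultimately show ?thesis using c
    proof eventually_elim
      case (elim t)
      have "vscale E t (vscale E (inverse t) (c t - x)) = c t - x"
        using is_vector_spaceD(6)[OF V vcarrier_minus[OF V elim(3) xE], of t "inverse t"]
          is_vector_spaceD(7)[OF V vcarrier_minus[OF V elim(3) xE]] elim(2) by simp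
      then show ?case using est[of t "vscale E (inverse t) (c t - x)"] elim by simp
    qed
  qed
  then have "((\<lambda>t. (f (c t) - f x) / t) \<longlongrightarrow> df (x, w)) (at 0)"
    by (intro tendstoI) (simp add: dist_norm)
  then show ?thesis ..
qed

section \<open>The complexification as a topological vector space\<close>

lemma vscale_diff_left:
  assumes "is_vector_space E" "x \<in> vcarrier E"
  shows "vscale E (c - d) x = vscale E c x - vscale E d x"
  using is_vector_spaceD(5)[OF assms, of "c - d" d] by simp

lemma vscale_diff_right:
  assumes "is_vector_space E" "x \<in> vcarrier E" "y \<in> vcarrier E"
  shows "vscale E c (x - y) = vscale E c x - vscale E c y"
  using is_vector_spaceD(4)[OF assms(1) vcarrier_minus[OF assms] assms(3), of c] by simp

text \<open>A holomorphic chart by itself assumes nothing about its model space. For the charts of a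
  totally real submanifold, this supplies the continuity of the vector operations used for affine
  discs.\<close>

lemma is_tvs_complexification:
  assumes V: "is_tvs (V :: (real, 'v::ab_group_add) tvs)"
  shows "is_tvs (complexification V)"
proof -
  note VS = is_tvsD(1)[OF V]
  note vs = is_vector_spaceD(1-5,7)[OF VS] is_vector_spaceD(6)[OF VS, symmetric] vcarrier_minus[OF VS]
    vscale_zero_left[OF VS] vscale_diff_left[OF VS] vscale_diff_right[OF VS]
  have "is_vector_space (complexification V)"
    unfolding is_vector_space_def complexification_def
    by (auto simp: zero_prod_def vs algebra_simps)
  moreover have "Hausdorff_space (vtop (complexification V))"
    using V by (simp add: is_tvs_def complexification_def Hausdorff_space_prod_topology)
  moreover have "continuous_map (prod_topology (vtop (complexification V)) (vtop (complexification V)))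
      (vtop (complexification V)) (\<lambda>(x, y). x + y)"
    unfolding complexification_def case_prod_unfold plus_prod_def
    by (simp, intro continuous_map_pairedI continuous_map_vadd[OF V]
        continuous_map_fst continuous_map_snd
        continuous_map_compose[OF continuous_map_fst continuous_map_fst, unfolded o_def]
        continuous_map_compose[OF continuous_map_snd continuous_map_fst, unfolded o_def]
        continuous_map_compose[OF continuous_map_fst continuous_map_snd, unfolded o_def]
        continuous_map_compose[OF continuous_map_snd continuous_map_snd, unfolded o_def])
  moreover have "continuous_map (prod_topology euclidean (vtop (complexification V)))
      (vtop (complexification V)) (\<lambda>(c, x). vscale (complexification V) c x)"
  proof -
    have Re: "continuous_map euclidean euclideanreal Re" and Im: "continuous_map euclidean euclideanreal Im"
      by (simp_all add: continuous_on_Re continuous_on_Im continuous_on_id)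
    show ?thesis
      unfolding complexification_def case_prod_unfold
      by (simp, intro continuous_map_pairedI continuous_map_vadd[OF V] continuous_map_vminus[OF V] continuous_map_vscale[OF V]
        continuous_map_compose[OF continuous_map_fst Re, unfolded o_def]
        continuous_map_compose[OF continuous_map_fst Im, unfolded o_def]
        continuous_map_compose[OF continuous_map_snd continuous_map_fst, unfolded o_def]
        continuous_map_compose[OF continuous_map_snd continuous_map_snd, unfolded o_def])
  qed
  ultimately show ?thesis by (simp add: is_tvs_def)
qed

section \<open>Charts of a complex manifold\<close>

lemma is_chartD:
  assumes "is_chart T (E, U, \<phi>)"
  shows "openin T U" "U \<subseteq> topspace T" "openin (vtop E) (\<phi> ` U)" "\<phi> ` U \<subseteq> vcarrier E" "inj_on \<phi> U"
    and "homeomorphic_map (subtopology T U) (subtopology (vtop E) (\<phi> ` U)) \<phi>"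
    and "continuous_map (subtopology T U) (vtop E) \<phi>"
    and "continuous_map (subtopology (vtop E) (\<phi> ` U)) T (inv_into U \<phi>)"
proof -
  show U: "openin T U" and O: "openin (vtop E) (\<phi> ` U)"
    and h: "homeomorphic_map (subtopology T U) (subtopology (vtop E) (\<phi> ` U)) \<phi>"
    using assms by (auto simp: is_chart_def)
  show UT: "U \<subseteq> topspace T" and "\<phi> ` U \<subseteq> vcarrier E" using U O openin_subset by blast+
  then have top: "topspace (subtopology T U) = U" "topspace (subtopology (vtop E) (\<phi> ` U)) = \<phi> ` U"
    by auto
  show inj: "inj_on \<phi> U" using homeomorphic_imp_injective_map[OF h] top by simp
  show "continuous_map (subtopology T U) (vtop E) \<phi>"
    using homeomorphic_imp_continuous_map[OF h] continuous_map_into_fulltopology by blast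
  obtain g where g: "homeomorphic_maps (subtopology T U) (subtopology (vtop E) (\<phi> ` U)) \<phi> g"
    using h homeomorphic_map_maps by blast
  then have "continuous_map (subtopology (vtop E) (\<phi> ` U)) T g"
    using continuous_map_into_fulltopology unfolding homeomorphic_maps_def by blast
  moreover have "g y = inv_into U \<phi> y" if "y \<in> \<phi> ` U" for y
    using g that inj top unfolding homeomorphic_maps_def by (auto simp: inv_into_f_f)
  ultimately show "continuous_map (subtopology (vtop E) (\<phi> ` U)) T (inv_into U \<phi>)"
    by (metis (no_types, lifting) continuous_map_eq top(2))
qed

lemma is_chart_open_image:
  assumes c: "is_chart T (E, U, \<phi>)" and G: "openin T G" "G \<subseteq> U"
  shows "openin (vtop E) (\<phi> ` G)"
proof -
  have "openin (subtopology T U) G"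
    using G by (metis openin_open_subtopology is_chartD(1)[OF c])
  then have "openin (subtopology (vtop E) (\<phi> ` U)) (\<phi> ` G)"
    using homeomorphic_imp_open_map[OF is_chartD(6)[OF c]] by (simp add: open_map_def)
  then show ?thesis using openin_trans_full is_chartD(3)[OF c] by blast
qed

lemma is_chart_open_preimage:
  assumes c: "is_chart T (E, U, \<phi>)" and A: "openin (vtop E) A"
  shows "openin T {p \<in> U. \<phi> p \<in> A}"
proof -
  have "openin (subtopology T U) {p \<in> topspace (subtopology T U). \<phi> p \<in> A}"
    by (rule openin_continuous_map_preimage[OF is_chartD(7)[OF c] A])
  moreover have "topspace (subtopology T U) = U" using is_chartD(2)[OF c] by auto
  ultimately show ?thesis using openin_trans_full is_chartD(1)[OF c] by fastforce
qed

lemma complex_frechet_manifoldD: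
  assumes "complex_frechet_manifold M" "(E, U, \<phi>) \<in> matlas M"
  shows "is_tvs E" "is_chart (mtop M) (E, U, \<phi>)" "holomorphic_chart M (E, U, \<phi>)"
proof -
  have "\<forall>a\<in>matlas M. case a of (E, U, \<phi>) \<Rightarrow> is_frechet E \<and> is_chart (mtop M) (E, U, \<phi>)"
    and "\<forall>a\<in>matlas M. \<forall>b\<in>matlas M. compatible a b"
    using assms(1) by (auto simp: complex_frechet_manifold_def)
  from bspec[OF this(1) assms(2)] bspec[OF this(2) assms(2)]
  show "is_tvs E" "is_chart (mtop M) (E, U, \<phi>)" "holomorphic_chart M (E, U, \<phi>)"
    by (simp_all add: is_frechet_def is_lcs_def holomorphic_chart_def)
qed

lemma complex_frechet_manifold_chart_at:
  assumes "complex_frechet_manifold M" "p \<in> topspace (mtop M)"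
  obtains E U \<phi> where "(E, U, \<phi>) \<in> matlas M" "p \<in> U"
  using assms unfolding complex_frechet_manifold_def by fast

section \<open>Holomorphic kernels: sections and continuity\<close>

lemma holomorphic_kernelD:
  assumes "holomorphic_kernel M K" "(E, U, \<phi>) \<in> matlas M" "(F, W, \<psi>) \<in> matlas M"
  shows "holo_on (prod_tvs E (conj_tvs F)) complex_line (\<phi> ` U \<times> \<psi> ` W) (K \<circ> inv_into (U \<times> W) (map_prod \<phi> \<psi>))"
proof -
  have "(prod_tvs E (conj_tvs F), U \<times> W, map_prod \<phi> \<psi>) \<in> matlas (prod_manifold M (conj_manifold M))"
    using assms(2,3) by (force simp: prod_manifold_def conj_manifold_def)
  moreover have "map_prod \<phi> \<psi> ` (U \<times> W) = \<phi> ` U \<times> \<psi> ` W" by auto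
  ultimately show ?thesis
    using assms(1) unfolding holomorphic_kernel_def holomorphic_function_def by fastforce
qed

lemma inv_into_map_prod:
  assumes "inj_on \<phi> U" "inj_on \<psi> W" "x \<in> U" "y \<in> W"
  shows "inv_into (U \<times> W) (map_prod \<phi> \<psi>) (\<phi> x, \<psi> y) = (x, y)"
  using inv_into_f_f[OF map_prod_inj_on[OF assms(1,2)], of "(x, y)"] assms(3,4) by simp

lemma holomorphic_kernel_section1:
  assumes M: "complex_frechet_manifold M" and K: "holomorphic_kernel M K" and y: "y \<in> topspace (mtop M)"
  shows "holomorphic_function M (\<lambda>x. K (x, y))"
  unfolding holomorphic_function_def
proof clarify
  fix E U \<phi> assume U: "(E, U, \<phi>) \<in> matlas M"
  obtain F W \<psi> where W: "(F, W, \<psi>) \<in> matlas M" "y \<in> W"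
    using complex_frechet_manifold_chart_at[OF M y] .
  note cU = complex_frechet_manifoldD[OF M U] and cW = complex_frechet_manifoldD[OF M W(1)]
  have "is_vector_space (conj_tvs F)"
    using is_tvsD(1)[OF cW(1)] by (simp add: is_vector_space_def conj_tvs_def)
  then have "holo_on E complex_line (\<phi> ` U) (\<lambda>x. (K \<circ> inv_into (U \<times> W) (map_prod \<phi> \<psi>)) (x, \<psi> y))"
    by (rule holo_on_section1[OF _ holomorphic_kernelD[OF K U W(1)]])
       (use W is_chartD(3)[OF cW(2)] in \<open>auto simp: conj_tvs_def\<close>)
  then show "holo_on E complex_line (\<phi> ` U) ((\<lambda>x. K (x, y)) \<circ> inv_into U \<phi>)"
    by (rule holo_on_cong[OF cU(1)])
       (auto simp: inv_into_map_prod is_chartD(5)[OF cU(2)] is_chartD(5)[OF cW(2)] W)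
qed

text \<open>After conjugation the second section is holomorphic on \<open>M\<close> itself rather
  than on the conjugate manifold, so the same discs serve both variables.\<close>

lemma holomorphic_kernel_section2:
  assumes M: "complex_frechet_manifold M" and K: "holomorphic_kernel M K" and x: "x \<in> topspace (mtop M)"
  shows "holomorphic_function M (\<lambda>y. cnj (K (x, y)))"
  unfolding holomorphic_function_def
proof clarify
  fix F W \<psi> assume W: "(F, W, \<psi>) \<in> matlas M"
  obtain E U \<phi> where U: "(E, U, \<phi>) \<in> matlas M" "x \<in> U"
    using complex_frechet_manifold_chart_at[OF M x] .
  note cU = complex_frechet_manifoldD[OF M U(1)] and cW = complex_frechet_manifoldD[OF M W]
  have "holo_on F complex_line (\<psi> ` W) (\<lambda>y. cnj ((K \<circ> inv_into (U \<times> W) (map_prod \<phi> \<psi>)) (\<phi> x, y)))"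
    by (rule holo_on_section2[OF is_tvsD(1)[OF cU(1)] holomorphic_kernelD[OF K U(1) W]])
       (use U is_chartD(3)[OF cU(2)] in auto)
  then show "holo_on F complex_line (\<psi> ` W) ((\<lambda>y. cnj (K (x, y))) \<circ> inv_into W \<psi>)"
    by (rule holo_on_cong[OF cW(1)])
       (auto simp: inv_into_map_prod is_chartD(5)[OF cU(2)] is_chartD(5)[OF cW(2)] U)
qed

text \<open>Conjugation leaves the topology unchanged. In each product chart continuity is part of
  holomorphy, and the product chart domains form an open cover.\<close>

lemma continuous_map_holomorphic_kernel:
  assumes M: "complex_frechet_manifold M" and K: "holomorphic_kernel M K"
  shows "continuous_map (prod_topology (mtop M) (mtop M)) euclidean K"
proof (rule pasting_lemma[where I = "matlas M \<times> matlas M" and f = "\<lambda>_. K" and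
      T = "\<lambda>(a, b). fst (snd a) \<times> fst (snd b)"])
  fix i assume i: "i \<in> matlas M \<times> matlas M"
  obtain E U \<phi> F W \<psi> where eq: "i = ((E, U, \<phi>), (F, W, \<psi>))" by (metis prod.exhaust)
  with i have U: "(E, U, \<phi>) \<in> matlas M" and W: "(F, W, \<psi>) \<in> matlas M" by auto
  note cU = complex_frechet_manifoldD[OF M U] and cW = complex_frechet_manifoldD[OF M W]
  show "openin (prod_topology (mtop M) (mtop M)) (case i of (a, b) \<Rightarrow> fst (snd a) \<times> fst (snd b))"
    using is_chartD(1)[OF cU(2)] is_chartD(1)[OF cW(2)] by (simp add: eq openin_prod_Times_iff)
  let ?X = "subtopology (prod_topology (mtop M) (mtop M)) (U \<times> W)"
  have X: "?X = prod_topology (subtopology (mtop M) U) (subtopology (mtop M) W)"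
    by (simp add: subtopology_Times)
  have "continuous_map ?X (prod_topology (vtop E) (vtop F)) (\<lambda>z. (\<phi> (fst z), \<psi> (snd z)))"
    unfolding X
    by (intro continuous_map_pairedI
        continuous_map_compose[OF continuous_map_fst is_chartD(7)[OF cU(2)], unfolded o_def]
        continuous_map_compose[OF continuous_map_snd is_chartD(7)[OF cW(2)], unfolded o_def])
  then have "continuous_map ?X (subtopology (vtop (prod_tvs E (conj_tvs F))) (\<phi> ` U \<times> \<psi> ` W)) (\<lambda>z. (\<phi> (fst z), \<psi> (snd z)))"
    by (auto simp: continuous_map_in_subtopology prod_tvs_def conj_tvs_def)
  moreover have "continuous_map (subtopology (vtop (prod_tvs E (conj_tvs F))) (\<phi> ` U \<times> \<psi> ` W)) euclidean
      (K \<circ> inv_into (U \<times> W) (map_prod \<phi> \<psi>))"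
    using holomorphic_kernelD[OF K U W] by (simp add: holo_on_def complex_line_def)
  ultimately have "continuous_map ?X euclidean ((K \<circ> inv_into (U \<times> W) (map_prod \<phi> \<psi>)) \<circ> (\<lambda>z. (\<phi> (fst z), \<psi> (snd z))))"
    by (rule continuous_map_compose)
  then have "continuous_map ?X euclidean K"
    by (rule continuous_map_eq)
       (auto simp: inv_into_map_prod is_chartD(5)[OF cU(2)] is_chartD(5)[OF cW(2)])
  then show "continuous_map (subtopology (prod_topology (mtop M) (mtop M)) (case i of (a, b) \<Rightarrow> fst (snd a) \<times> fst (snd b))) euclidean K"
    by (simp add: eq)
next
  fix z assume "z \<in> topspace (prod_topology (mtop M) (mtop M))"
  then have "fst z \<in> topspace (mtop M)" "snd z \<in> topspace (mtop M)" by auto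
  then obtain E U \<phi> F W \<psi> where "(E, U, \<phi>) \<in> matlas M" "fst z \<in> U" "(F, W, \<psi>) \<in> matlas M" "snd z \<in> W"
    by (metis complex_frechet_manifold_chart_at[OF M])
  then show "\<exists>j. j \<in> matlas M \<times> matlas M \<and> z \<in> (case j of (a, b) \<Rightarrow> fst (snd a) \<times> fst (snd b)) \<and> K z = K z"
    by (intro exI[of _ "((E, U, \<phi>), (F, W, \<psi>))"]) (auto simp: mem_Times_iff)
qed auto

section \<open>Affine discs in charts\<close>

text \<open>\<open>f\<close> is given as holomorphic in the atlas charts, whereas the chart
  \<open>(E, U, \<phi>)\<close> is only compatible with them. Near each parameter the disc is
  therefore moved into an atlas chart by the transition map, where the chain rule applies.\<close>

lemma holomorphic_on_affine_disc:
  assumes M: "complex_frechet_manifold M" and f: "holomorphic_function M f"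
    and U: "holomorphic_chart M (E, U, \<phi>)" and E: "is_tvs E"
    and ab: "a \<in> vcarrier E" "b \<in> vcarrier E"
    and disc: "\<And>t. t \<in> D \<Longrightarrow> a + vscale E t b \<in> \<phi> ` U"
  shows "(\<lambda>t. f (inv_into U \<phi> (a + vscale E t b))) holomorphic_on D"
proof -
  define \<gamma> where "\<gamma> t = inv_into U \<phi> (a + vscale E t b)" for t
  have cU: "is_chart (mtop M) (E, U, \<phi>)" using U by (simp add: holomorphic_chart_def)
  have "\<exists>D'. ((\<lambda>h. (f (\<gamma> (t + h)) - f (\<gamma> t)) / h) \<longlongrightarrow> D') (at 0)" if t: "t \<in> D" for t
  proof -
    have \<gamma>t: "\<gamma> t \<in> U" "\<phi> (\<gamma> t) = a + vscale E t b"
      using disc[OF t] by (auto simp: \<gamma>_def inv_into_into f_inv_into_f)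
    then obtain F W \<psi> where W: "(F, W, \<psi>) \<in> matlas M" "\<gamma> t \<in> W"
      using complex_frechet_manifold_chart_at[OF M] is_chartD(2)[OF cU] by blast
    note cW = complex_frechet_manifoldD[OF M W(1)]
    let ?A = "\<phi> ` (U \<inter> W)"
    have hol: "holo_on E F ?A (\<psi> \<circ> inv_into U \<phi>)"
      using U W(1) unfolding holomorphic_chart_def compatible_def by fastforce
    then have A: "openin (vtop E) ?A" by (simp add: holo_on_def)
    have x: "a + vscale E t b \<in> ?A" using \<gamma>t W(2) by (metis IntI imageI)
    \<comment> \<open>The directional derivative of the transition map along \<open>b\<close> is the
      velocity of the disc as seen in the atlas chart.\<close>
    then obtain w where w: "limitin (vtop F) (\<lambda>h. vscale F (inverse h)
        ((\<psi> \<circ> inv_into U \<phi>) (a + vscale E t b + vscale E h b) - (\<psi> \<circ> inv_into U \<phi>) (a + vscale E t b))) w (at 0)"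
      using hol ab unfolding holo_on_def by blast
    have shift: "a + vscale E t b + vscale E h b = a + vscale E (t + h) b" for h
      using is_vector_spaceD(5)[OF is_tvsD(1)[OF E] ab(2)] by (simp add: add.assoc)
    have w': "limitin (vtop F) (\<lambda>h. vscale F (inverse h) (\<psi> (\<gamma> (t + h)) - \<psi> (\<gamma> t))) w (at 0)"
      using w by (simp add: shift \<gamma>_def)
    have "open {h. a + vscale E t b + vscale E h b \<in> ?A}"
      using open_affine_preimage[OF E A _ ab(2)] openin_subset[OF A] x by blast
    moreover have "0 \<in> {h. a + vscale E t b + vscale E h b \<in> ?A}"
      using x vscale_zero_left[OF is_tvsD(1)[OF E] ab(2)] by simp
    ultimately have "\<forall>\<^sub>F h in at 0. a + vscale E t b + vscale E h b \<in> ?A"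
      using eventually_at_topological by blast
    then have ev: "\<forall>\<^sub>F h in at 0. \<gamma> (t + h) \<in> W"
      by eventually_elim (auto simp: shift \<gamma>_def inv_into_f_f is_chartD(5)[OF cU])
    have "holo_on F complex_line (\<psi> ` W) (f \<circ> inv_into W \<psi>)"
      using f W(1) unfolding holomorphic_function_def by blast
    moreover have "\<forall>\<^sub>F h in at 0. \<psi> (\<gamma> (t + h)) \<in> vcarrier F"
      using ev by eventually_elim (use is_chartD(4)[OF cW(2)] in blast)
    ultimately obtain D' where
      "((\<lambda>h. ((f \<circ> inv_into W \<psi>) (\<psi> (\<gamma> (t + h))) - (f \<circ> inv_into W \<psi>) (\<psi> (\<gamma> t))) / h) \<longlongrightarrow> D') (at 0)"
      using holo_on_chain_rule[OF cW(1) _ _ _ w'] W(2) by blast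
    moreover have "\<forall>\<^sub>F h in at 0. ((f \<circ> inv_into W \<psi>) (\<psi> (\<gamma> (t + h))) - (f \<circ> inv_into W \<psi>) (\<psi> (\<gamma> t))) / h
        = (f (\<gamma> (t + h)) - f (\<gamma> t)) / h"
      using ev by eventually_elim (simp add: inv_into_f_f is_chartD(5)[OF cW(2)] W(2))
    ultimately show ?thesis using tendsto_cong by fast
  qed
  then have "\<exists>D'. ((\<lambda>t. f (\<gamma> t)) has_field_derivative D') (at t)" if "t \<in> D" for t
    using that by (simp add: DERIV_def)
  then show ?thesis
    unfolding holomorphic_on_def field_differentiable_def \<gamma>_def[symmetric]
    by (meson has_field_derivative_at_within)
qed

text \<open>Membership in \<open>S\<close> is demanded only for small positive real parameters. This
  covers discs that start in an open set as well as discs that meet a totally real submanifold along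
  a real segment.\<close>

lemma positive_definite_on_insert_affine_disc:
  assumes M: "complex_frechet_manifold M" and K: "holomorphic_kernel M K"
    and U: "holomorphic_chart M (E, U, \<phi>)" and E: "is_tvs E"
    and S: "S \<subseteq> topspace (mtop M)" "positive_definite_on S K"
    and ab: "a \<in> vcarrier E" "b \<in> vcarrier E"
    and disc: "\<And>t. t \<in> ball 0 11 \<Longrightarrow> a + vscale E t b \<in> \<phi> ` U"
    and e: "e > 0" "\<And>r. 0 < r \<Longrightarrow> r < e \<Longrightarrow> inv_into U \<phi> (a + vscale E (of_real r) b) \<in> S"
    and t0: "norm t0 \<le> 1"
  shows "positive_definite_on (insert (inv_into U \<phi> (a + vscale E t0 b)) S) K"
proof -
  define \<gamma> where "\<gamma> t = inv_into U \<phi> (a + vscale E t b)" for t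
  have cU: "is_chart (mtop M) (E, U, \<phi>)" using U by (simp add: holomorphic_chart_def)
  have "\<gamma> t \<in> U" if "t \<in> ball 0 11" for t
    using disc[OF that] by (simp add: \<gamma>_def inv_into_into)
  then have sub: "S \<union> \<gamma> ` ball 0 11 \<subseteq> topspace (mtop M)"
    using S(1) is_chartD(2)[OF cU] by blast
  have "continuous_map (top_of_set (ball 0 11)) (vtop E) (\<lambda>t. a + vscale E t b)"
    by (intro continuous_map_vadd[OF E] continuous_map_vscale[OF E]) (use ab in auto)
  then have "continuous_map (top_of_set (ball 0 11)) (subtopology (vtop E) (\<phi> ` U)) (\<lambda>t. a + vscale E t b)"
    using disc by (auto simp: continuous_map_in_subtopology)
  from continuous_map_compose[OF this is_chartD(8)[OF cU]]
  have c\<gamma>: "continuous_map (top_of_set (ball 0 11)) (mtop M) \<gamma>"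
    by (simp add: o_def \<gamma>_def[abs_def])
  have "continuous_map (prod_topology (top_of_set (ball 0 11)) (top_of_set (ball 0 11)))
      (prod_topology (mtop M) (mtop M)) (\<lambda>z. (\<gamma> (fst z), \<gamma> (snd z)))"
    by (intro continuous_map_pairedI
        continuous_map_compose[OF continuous_map_fst c\<gamma>, unfolded o_def]
        continuous_map_compose[OF continuous_map_snd c\<gamma>, unfolded o_def])
  from continuous_map_compose[OF this continuous_map_holomorphic_kernel[OF M K]]
  have "continuous_map (top_of_set (ball 0 11 \<times> ball 0 11)) euclidean (\<lambda>(p, q). K (\<gamma> p, \<gamma> q))"
    by (simp add: o_def case_prod_unfold subtopology_Times[symmetric] del: continuous_map_iff_continuous)
  then have cont: "continuous_on (ball 0 11 \<times> ball 0 11) (\<lambda>(p, q). K (\<gamma> p, \<gamma> q))"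
    by simp
  define \<delta> where "\<delta> = min e 1"
  have \<delta>: "0 < \<delta>" "\<delta> \<le> e" "\<delta> \<le> 1" using e by (auto simp: \<delta>_def)
  \<comment> \<open>The nodes are distinct points of the real segment; the shift by 2 makes even the
    first one strictly smaller than \<open>\<delta>\<close>, hence than \<open>e\<close>.\<close>
  define s where "s l = complex_of_real (\<delta> / (real l + 2))" for l
  have small: "\<delta> / (real l + 2) < \<delta>" "0 < \<delta> / (real l + 2)" for l
    using \<delta> by (auto simp: field_simps intro!: add_pos_nonneg)
  show ?thesis
    unfolding \<gamma>_def[symmetric]
  proof (rule positive_definite_on_insert_disc[OF S(2) _ _ cont _ _ _ t0])
    fix x assume "x \<in> S \<union> \<gamma> ` ball 0 11"
    then have x: "x \<in> topspace (mtop M)" using sub by blast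
    show "(\<lambda>t. K (\<gamma> t, x)) holomorphic_on ball 0 11"
      unfolding \<gamma>_def
      by (rule holomorphic_on_affine_disc[OF M holomorphic_kernel_section1[OF M K x] U E ab disc])
    show "(\<lambda>t. cnj (K (x, \<gamma> t))) holomorphic_on ball 0 11"
      unfolding \<gamma>_def
      by (rule holomorphic_on_affine_disc[OF M holomorphic_kernel_section2[OF M K x] U E ab disc])
  next
    show "inj s" using \<delta>(1) by (auto simp: inj_def s_def field_simps)
    show "norm (s l) \<le> 1" for l
      unfolding s_def norm_of_real using small[of l] \<delta> by linarith
    show "\<gamma> (s l) \<in> S" for l
      unfolding s_def \<gamma>_def using small[of l] \<delta> by (intro e(2)) linarith+
  qed
qed

section \<open>Maximal sets of positive definiteness\<close>

text \<open>A quadratic form involves finitely many points, and these already lie in one member of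
  the chain.\<close>

lemma positive_definite_on_Union_chain:
  assumes "subset.chain \<A> \<C>" "\<C> \<noteq> {}" "\<And>X. X \<in> \<C> \<Longrightarrow> positive_definite_on X K"
  shows "positive_definite_on (\<Union>\<C>) K"
  unfolding positive_definite_on_def
proof (intro allI impI)
  fix m :: nat and x :: "nat \<Rightarrow> 'a" and c :: "nat \<Rightarrow> complex"
  assume "\<forall>j<m. x j \<in> \<Union>\<C>"
  then have "x ` {..<m} \<subseteq> \<Union>\<C>" by auto
  then obtain X where "X \<in> \<C>" "x ` {..<m} \<subseteq> X"
    using finite_subset_Union_chain[OF _ _ assms(2,1)] by (metis finite_imageI finite_lessThan)
  then show "(\<Sum>j<m. \<Sum>k<m. c k * cnj (c j) * K (x j, x k)) \<in> \<real>\<^sub>\<ge>\<^sub>0"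
    using assms(3) unfolding positive_definite_on_def by (simp add: image_subset_iff)
qed

text \<open>Zorn's lemma. Maximality is stated for extensions by one point, which is what the disc
  argument produces.\<close>

lemma maximal_positive_definite_on:
  assumes "X \<subseteq> T" "positive_definite_on X K"
  obtains S where "X \<subseteq> S" "S \<subseteq> T" "positive_definite_on S K"
    "\<And>y. y \<in> T \<Longrightarrow> positive_definite_on (insert y S) K \<Longrightarrow> y \<in> S"
proof -
  let ?A = "{S. X \<subseteq> S \<and> S \<subseteq> T \<and> positive_definite_on S K}"
  have "\<exists>S\<in>?A. \<forall>Y\<in>?A. S \<subseteq> Y \<longrightarrow> Y = S"
  proof (rule subset_Zorn_nonempty)
    show "?A \<noteq> {}" using assms by blast
    fix \<C> assume \<C>: "\<C> \<noteq> {}" "subset.chain ?A \<C>"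
    then have sub: "\<C> \<subseteq> ?A" by (simp add: subset.chain_def)
    then have "positive_definite_on (\<Union>\<C>) K"
      by (intro positive_definite_on_Union_chain[OF \<C>(2,1)]) blast
    then show "\<Union>\<C> \<in> ?A" using sub \<C>(1) by blast
  qed
  then obtain S where S: "S \<in> ?A" "\<forall>Y\<in>?A. S \<subseteq> Y \<longrightarrow> Y = S" ..
  have "y \<in> S" if "y \<in> T" "positive_definite_on (insert y S) K" for y
  proof -
    have "insert y S \<in> ?A" using S(1) that by auto
    then show ?thesis using S(2) by blast
  qed
  moreover have "X \<subseteq> S" "S \<subseteq> T" "positive_definite_on S K" using S(1) by auto
  ultimately show thesis using that by simp
qed

section \<open>Propagation over a connected manifold\<close>

text \<open>A limit point \<open>p\<close> of the interior \<open>G\<close> has a neighbourhood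
  \<open>N\<close> any two points of which are joined by a large affine disc inside one chart. A
  disc from some \<open>q\<close> in \<open>G\<close> and \<open>N\<close> to \<open>y\<close> in
  \<open>N\<close> puts \<open>y\<close> into \<open>S\<close>, so \<open>p\<close> is interior as
  well.\<close>

lemma maximal_positive_definite_on_eq_topspace:
  assumes M: "complex_frechet_manifold M" and conn: "connected_space (mtop M)" and K: "holomorphic_kernel M K"
    and S: "S \<subseteq> topspace (mtop M)" "positive_definite_on S K"
    and max: "\<And>y. y \<in> topspace (mtop M) \<Longrightarrow> positive_definite_on (insert y S) K \<Longrightarrow> y \<in> S"
    and int: "(mtop M) interior_of S \<noteq> {}"
  shows "S = topspace (mtop M)"
proof -
  define G where "G = (mtop M) interior_of S"
  have G: "openin (mtop M) G" "G \<subseteq> S" by (simp_all add: G_def interior_of_subset)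
  have "p \<in> G" if p: "p \<in> (mtop M) closure_of G" for p
  proof -
    have "p \<in> topspace (mtop M)" using p by (simp add: in_closure_of)
    then obtain E U \<phi> where U: "(E, U, \<phi>) \<in> matlas M" "p \<in> U"
      using complex_frechet_manifold_chart_at[OF M] by blast
    note E = complex_frechet_manifoldD(1)[OF M U(1)] and cU = complex_frechet_manifoldD(2)[OF M U(1)]
    note V = is_tvsD(1)[OF E]
    define a where "a = \<phi> p"
    have a: "a \<in> \<phi> ` U" "a \<in> vcarrier E" using U(2) is_chartD(4)[OF cU] by (auto simp: a_def)
    \<comment> \<open>\<open>?f\<close> maps \<open>(t, (u, v))\<close> to
      \<open>u + t (v - u)\<close>, which is constantly \<open>a\<close> when \<open>u\<close> and
      \<open>v\<close> both equal \<open>a\<close>. The tube lemma over the compact disc then keeps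
      the discs through all pairs near \<open>(a, a)\<close> inside the chart.\<close>
    let ?P = "prod_topology euclidean (prod_topology (vtop E) (vtop E))"
    let ?f = "\<lambda>z. fst (snd z) + vscale E (fst z) (snd (snd z) - fst (snd z))"
    have "continuous_map ?P (vtop E) ?f"
      by (intro continuous_map_vadd[OF E] continuous_map_vminus[OF E] continuous_map_vscale[OF E]
        continuous_map_fst
        continuous_map_compose[OF continuous_map_snd continuous_map_fst, unfolded o_def]
        continuous_map_compose[OF continuous_map_snd continuous_map_snd, unfolded o_def])
    then have W: "openin ?P {z \<in> topspace ?P. ?f z \<in> \<phi> ` U}"
      by (rule openin_continuous_map_preimage) (rule is_chartD(3)[OF cU])
    have sub: "cball 0 11 \<times> {(a, a)} \<subseteq> {z \<in> topspace ?P. ?f z \<in> \<phi> ` U}"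
      using a vscale_zero_right[OF V] by auto
    have cpt: "compactin euclidean (cball (0::complex) 11)" by simp
    have aa: "(a, a) \<in> topspace (prod_topology (vtop E) (vtop E))" using a by simp
    obtain O1 O2 where O12: "openin (prod_topology (vtop E) (vtop E)) O2" "cball 0 11 \<subseteq> O1" "(a, a) \<in> O2"
        "O1 \<times> O2 \<subseteq> {z \<in> topspace ?P. ?f z \<in> \<phi> ` U}"
      using tube_lemma_left[OF W cpt aa sub] by blast
    then obtain A1 A2 where A12: "openin (vtop E) A1" "openin (vtop E) A2" "a \<in> A1" "a \<in> A2" "A1 \<times> A2 \<subseteq> O2"
      unfolding openin_prod_topology_alt by meson
    define N where "N = {q \<in> U. \<phi> q \<in> A1 \<inter> A2}"
    have N: "openin (mtop M) N" unfolding N_def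
      using is_chart_open_preimage[OF cU openin_Int[OF A12(1,2)]] .
    have pN: "p \<in> N" using U(2) A12 by (simp add: N_def a_def)
    then obtain q where q: "q \<in> G" "q \<in> N" using p N unfolding in_closure_of by blast
    have "y \<in> S" if y: "y \<in> N" for y
    proof -
      have qy: "\<phi> q \<in> vcarrier E" "\<phi> y \<in> vcarrier E" "q \<in> U" "y \<in> U"
        using q y is_chartD(4)[OF cU] by (auto simp: N_def)
      let ?b = "\<phi> y - \<phi> q"
      have b: "?b \<in> vcarrier E" using vcarrier_minus[OF V] qy by simp
      have "(\<phi> q, \<phi> y) \<in> O2" using A12(5) q y by (auto simp: N_def)
      then have disc: "\<phi> q + vscale E t ?b \<in> \<phi> ` U" if "t \<in> ball 0 11" for t
        using O12(2,4) that by force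
      \<comment> \<open>The disc starts at \<open>q\<close>, in the open set \<open>G\<close>, so it
        stays in \<open>G\<close> for small parameters, in particular small positive real
        ones.\<close>
      have "openin (vtop E) (\<phi> ` (G \<inter> U))"
        using G(1) is_chartD(1)[OF cU] by (intro is_chart_open_image[OF cU]) auto
      then have "open {t. \<phi> q + vscale E t ?b \<in> \<phi> ` (G \<inter> U)}"
        using open_affine_preimage[OF E _ qy(1) b] by blast
      moreover have "0 \<in> {t. \<phi> q + vscale E t ?b \<in> \<phi> ` (G \<inter> U)}"
        using vscale_zero_left[OF V b] q qy by simp
      ultimately obtain e where e: "e > 0" "ball 0 e \<subseteq> {t. \<phi> q + vscale E t ?b \<in> \<phi> ` (G \<inter> U)}"
        by (meson open_contains_ball)
      have "inv_into U \<phi> (\<phi> q + vscale E (of_real r) ?b) \<in> S" if "0 < r" "r < e" for r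
      proof -
        have "of_real r \<in> ball (0::complex) e" using that by simp
        then have "\<phi> q + vscale E (of_real r) ?b \<in> \<phi> ` (G \<inter> U)" using e(2) by blast
        then show ?thesis using G(2) by (auto simp: inv_into_f_f[OF is_chartD(5)[OF cU]])
      qed
      \<comment> \<open>The disc is at \<open>q\<close> for parameter 0 and reaches \<open>y\<close>
        at parameter 1.\<close>
      from positive_definite_on_insert_affine_disc[OF M K complex_frechet_manifoldD(3)[OF M U(1)] E S qy(1) b disc e(1) this, of 1]
      have "positive_definite_on (insert (inv_into U \<phi> (\<phi> q + vscale E 1 ?b)) S) K" by simp
      moreover have "inv_into U \<phi> (\<phi> q + vscale E 1 ?b) = y"
        using is_vector_spaceD(7)[OF V b] inv_into_f_f[OF is_chartD(5)[OF cU] qy(4)] by simp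
      ultimately show "y \<in> S"
        using max qy(4) is_chartD(2)[OF cU] by auto
    qed
    then have "N \<subseteq> S" by blast
    then show "p \<in> G" unfolding G_def using N pN by (meson interior_of_maximal subsetD)
  qed
  then have "closedin (mtop M) G"
    by (metis G(1) closure_of_eq closure_of_subset openin_subset subsetI subset_antisym)
  then have "G = topspace (mtop M)"
    using conn G(1) int unfolding connected_space_clopen_in G_def by blast
  then show ?thesis using G(2) S(1) by blast
qed

section \<open>From a totally real submanifold to an open set\<close>

text \<open>Provides the starting open set for propagation. Each point \<open>v + \<i> w\<close> of
  the complexification is the value at \<open>\<i>\<close> of the disc \<open>v + t w\<close>, whose
  real parameters give points of the real space.\<close>

lemma totally_real_maximal_positive_definite_on_interior:
  assumes M: "complex_frechet_manifold M" and K: "holomorphic_kernel M K"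
    and \<Sigma>: "totally_real_submanifold TYPE('v::ab_group_add) M \<Sigma>" "\<Sigma> \<noteq> {}" "\<Sigma> \<subseteq> S"
    and S: "S \<subseteq> topspace (mtop M)" "positive_definite_on S K"
    and max: "\<And>y. y \<in> topspace (mtop M) \<Longrightarrow> positive_definite_on (insert y S) K \<Longrightarrow> y \<in> S"
  shows "(mtop M) interior_of S \<noteq> {}"
proof -
  obtain s where s: "s \<in> \<Sigma>" using \<Sigma>(2) by blast
  then obtain V :: "(real, 'v) tvs" and U \<phi> where V: "is_lcs V" and sU: "s \<in> U"
    and hU: "holomorphic_chart M (complexification V, U, \<phi>)"
    and \<Sigma>U: "\<phi> ` (U \<inter> \<Sigma>) = \<phi> ` U \<inter> (vcarrier V \<times> {0})"
    using \<Sigma>(1) unfolding totally_real_submanifold_def by blast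
  have tV: "is_tvs V" using V by (simp add: is_lcs_def)
  note VS = is_tvsD(1)[OF tV]
  define E where "E = complexification V"
  have E: "is_tvs E" unfolding E_def by (rule is_tvs_complexification[OF tV])
  have vE: "vtop E = prod_topology (vtop V) (vtop V)" by (simp add: E_def complexification_def)
  have hE: "holomorphic_chart M (E, U, \<phi>)" using hU by (simp add: E_def)
  then have cU: "is_chart (mtop M) (E, U, \<phi>)" by (simp add: holomorphic_chart_def)
  obtain v0 where v0: "\<phi> s = (v0, 0)" "v0 \<in> vcarrier V" using \<Sigma>U s sU by blast
  have line: "(v, 0) + vscale E t (w, 0) = (v + vscale V (Re t) w, vscale V (Im t) w)" for t v w
    by (simp add: E_def complexification_def vscale_zero_right[OF VS])
  \<comment> \<open>A point \<open>(v, w)\<close> of the model space doubles as the data of the disc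
    \<open>v + t w\<close>, and \<open>?f\<close> lists its real and imaginary parts. At
    \<open>(v0, 0)\<close> the disc is constantly the image of \<open>s\<close>, so the tube lemma
    yields a neighbourhood \<open>A\<close> of admissible data.\<close>
  let ?P = "prod_topology euclidean (vtop E)"
  let ?f = "\<lambda>z. (fst (snd z) + vscale V (Re (fst z)) (snd (snd z)), vscale V (Im (fst z)) (snd (snd z)))"
  have Re: "continuous_map euclidean euclideanreal Re" and Im: "continuous_map euclidean euclideanreal Im"
    by (simp_all add: continuous_on_Re continuous_on_Im continuous_on_id)
  have "continuous_map ?P (vtop E) ?f"
    unfolding vE
    by (intro continuous_map_pairedI continuous_map_vadd[OF tV] continuous_map_vscale[OF tV]
        continuous_map_compose[OF continuous_map_fst Re, unfolded o_def]
        continuous_map_compose[OF continuous_map_fst Im, unfolded o_def]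
        continuous_map_compose[OF continuous_map_snd continuous_map_fst, unfolded o_def]
        continuous_map_compose[OF continuous_map_snd continuous_map_snd, unfolded o_def])
  then have W: "openin ?P {z \<in> topspace ?P. ?f z \<in> \<phi> ` U}"
    by (rule openin_continuous_map_preimage) (rule is_chartD(3)[OF cU])
  have sub: "cball 0 11 \<times> {(v0, 0)} \<subseteq> {z \<in> topspace ?P. ?f z \<in> \<phi> ` U}"
    using v0 sU vscale_zero_right[OF VS] is_vector_spaceD(1)[OF VS] by (auto simp: vE) (metis imageI)+
  have cpt: "compactin euclidean (cball (0::complex) 11)" by simp
  have v0E: "(v0, 0) \<in> vcarrier E" using v0 is_vector_spaceD(1)[OF VS] by (simp add: vE)
  obtain O1 A where OA: "openin (vtop E) A" "cball 0 11 \<subseteq> O1" "(v0, 0) \<in> A"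
      "O1 \<times> A \<subseteq> {z \<in> topspace ?P. ?f z \<in> \<phi> ` U}"
    using tube_lemma_left[OF W cpt v0E sub] by blast
  define N where "N = {q \<in> U. \<phi> q \<in> A}"
  have N: "openin (mtop M) N" unfolding N_def
    using is_chart_open_preimage[OF cU OA(1)] .
  have "y \<in> S" if y: "y \<in> N" for y
  proof -
    obtain v w where vw: "\<phi> y = (v, w)" by fastforce
    have yU: "y \<in> U" and vwA: "(v, w) \<in> A" using y vw by (auto simp: N_def)
    then have vwV: "v \<in> vcarrier V" "w \<in> vcarrier V"
      using openin_subset[OF OA(1)] by (auto simp: vE)
    have ab: "(v, 0) \<in> vcarrier E" "(w, 0) \<in> vcarrier E"
      using vwV is_vector_spaceD(1)[OF VS] by (auto simp: vE)
    have disc: "(v, 0) + vscale E t (w, 0) \<in> \<phi> ` U" if "t \<in> ball 0 11" for t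
      unfolding line using OA(2,4) that vwA by force
    \<comment> \<open>For real parameters the imaginary part vanishes and the chart condition places
      the point on \<open>\<Sigma>\<close>. The bound 1 is a convenient choice inside the radius 11
      of the disc.\<close>
    have "inv_into U \<phi> ((v, 0) + vscale E (of_real r) (w, 0)) \<in> S" if "0 < r" "r < 1" for r
    proof -
      have "(v, 0) + vscale E (of_real r) (w, 0) \<in> vcarrier V \<times> {0}"
        unfolding line using vwV is_vector_spaceD(2,3)[OF VS] vscale_zero_left[OF VS] by simp
      then have "(v, 0) + vscale E (of_real r) (w, 0) \<in> \<phi> ` (U \<inter> \<Sigma>)"
        unfolding \<Sigma>U using disc[of "of_real r"] that by simp
      then show ?thesis using \<Sigma>(3) by (auto simp: inv_into_f_f[OF is_chartD(5)[OF cU]])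
    qed
    \<comment> \<open>At \<open>\<i>\<close> the disc takes the value \<open>(v, w)\<close>, the
      coordinates of \<open>y\<close>.\<close>
    from positive_definite_on_insert_affine_disc[OF M K hE E S ab disc zero_less_one this, of \<i>]
    have "positive_definite_on (insert (inv_into U \<phi> ((v, 0) + vscale E \<i> (w, 0))) S) K" by simp
    moreover have "(v, 0) + vscale E \<i> (w, 0) = \<phi> y"
      unfolding line vw using vscale_zero_left[OF VS vwV(2)] is_vector_spaceD(7)[OF VS vwV(2)] by simp
    ultimately show "y \<in> S"
      using max[of y] yU is_chartD(2)[OF cU] inv_into_f_f[OF is_chartD(5)[OF cU] yU] by auto
  qed
  then have "N \<subseteq> (mtop M) interior_of S"
    using N by (meson interior_of_maximal subsetI)
  moreover have "s \<in> N" using sU v0 OA(3) by (simp add: N_def)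
  ultimately show ?thesis by blast
qed

theorem theoremA1:
  fixes M :: "('m, 'e::ab_group_add) cmanifold"
    and K :: "'m \<times> 'm \<Rightarrow> complex"
  assumes "complex_frechet_manifold M"
    and "connected_space (mtop M)"
    and "holomorphic_kernel M K"
  shows "((\<exists>X. openin (mtop M) X \<and> X \<noteq> {} \<and> positive_definite_on X K)
            \<longrightarrow> positive_definite_on (topspace (mtop M)) K) \<and>
         ((\<exists>\<Sigma>. totally_real_submanifold TYPE('v::ab_group_add) M \<Sigma> \<and> \<Sigma> \<noteq> {} \<and>
                positive_definite_on \<Sigma> K)
            \<longrightarrow> positive_definite_on (topspace (mtop M)) K)"
proof (intro conjI impI; elim exE conjE)
  fix X assume X: "openin (mtop M) X" "X \<noteq> {}" "positive_definite_on X K"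
  obtain S where S: "X \<subseteq> S" "S \<subseteq> topspace (mtop M)" "positive_definite_on S K"
    "\<And>y. y \<in> topspace (mtop M) \<Longrightarrow> positive_definite_on (insert y S) K \<Longrightarrow> y \<in> S"
    using maximal_positive_definite_on[OF openin_subset[OF X(1)] X(3)] by blast
  have "(mtop M) interior_of S \<noteq> {}"
    using interior_of_maximal[OF S(1) X(1)] X(2) by blast
  from maximal_positive_definite_on_eq_topspace[OF assms S(2-4) this]
  show "positive_definite_on (topspace (mtop M)) K" using S(3) by simp
next
  fix \<Sigma> assume \<Sigma>: "totally_real_submanifold TYPE('v) M \<Sigma>" "\<Sigma> \<noteq> {}" "positive_definite_on \<Sigma> K"
  have "\<Sigma> \<subseteq> topspace (mtop M)" using \<Sigma>(1) by (simp add: totally_real_submanifold_def)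
  then obtain S where S: "\<Sigma> \<subseteq> S" "S \<subseteq> topspace (mtop M)" "positive_definite_on S K"
    "\<And>y. y \<in> topspace (mtop M) \<Longrightarrow> positive_definite_on (insert y S) K \<Longrightarrow> y \<in> S"
    using maximal_positive_definite_on[OF _ \<Sigma>(3)] by blast
  have "(mtop M) interior_of S \<noteq> {}"
    by (rule totally_real_maximal_positive_definite_on_interior[OF assms(1,3) \<Sigma>(1,2) S])
  from maximal_positive_definite_on_eq_topspace[OF assms S(2-4) this]
  show "positive_definite_on (topspace (mtop M)) K" using S(3) by simp
qed

end
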